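(* There is an additive $\mathbb{F}_2$-basis for $H^*(B\mathcal{S}_4;\mathbb{F}_2)$, where $\mathcal{S}_4$ is the symmetric group on four letters, given by the classes of the following cocycles in the mod-two Fox-Neuwirth cochain complex $\mathrm{FN}_4^*$ (all parameters being integers): \begin{itemize} \item $[a,0,0]+[0,a,0]+[0,0,a]$, with $a>0$; \item $[a,0,b]+[b,0,a]$, with $0<a<b$; \item $[b,a,b]$, with $0\le a\le b$. \end{itemize}
   Context: The mod-two Fox-Neuwirth cochain complex $\mathrm{FN}_n^*$ (for $n\ge 1$) is the $\mathbb{F}_2$-vector space with basis the sequences $\mathbf{a}=[a_1,\dots,a_{n-1}]$ of non-negative integers, where $\mathbf{a}$ has degree $\sum a_i$. Differential: $\delta(\mathbf{a})=\sum_{i=1}^{n-1}\delta_i(\mathbf{a})$, with $\delta_i$ defined as follows. Let $\ell=a_i$ and $\mathbf{a}[i]=[a_1,\dots,a_{i-1},a_i+1,a_{i+1},\dots,a_{n-1}]$. Let $\mathbf{A}_i$ be the maximal run of consecutive entries of $\mathbf{a}[i]$ that are all greater than $\ell$ and that contains the $i$th entry. The entries of $\mathbf{A}_i$ equal to $\ell+1$ act as separators, cutting $\mathbf{A}_i$ into an ordered list of $N$ (possibly empty) blocks of consecutive entries greater than $\ell+1$; thus $N$ is one more than the number of separators. Let $k$ be the number of these blocks lying to the left of the $i$th entry (which is itself a separator). For each $(k,N-k)$-shuffle $\sigma$, let $\sigma\cdot\mathbf{a}[i]$ be obtained from $\mathbf{a}[i]$ by reordering the $N$ blocks of $\mathbf{A}_i$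 by $\sigma$, with consecutive blocks again separated by single entries $\ell+1$. Then $\delta_i(\mathbf{a})=\sum_\sigma \sigma\cdot\mathbf{a}[i]$, the sum being over all $(k,N-k)$-shuffles $\sigma$, counted with multiplicity. Identification $H^*(\mathrm{FN}_n^* )\cong H^*(B\mathcal{S}_n;\mathbb{F}_2)$: let $\overline{\mathrm{Conf}}_n(\mathbb{R}^m)$ be the space of unordered configurations of $n$ distinct points in $\mathbb{R}^m$; the colimit over $m$ is a model for $B\mathcal{S}_n$. For $\mathbf{a}$ with all $a_i<m$, let $e_{\mathbf{a}}$ be the set of configurations whose points, listed in increasing dictionary order as $x_1<\dots<x_n$, satisfy: for each $p$, the first $a_p$ coordinates of $x_p$ and $x_{p+1}$ agree and their $(a_p+1)$st coordinates differ. The $e_{\mathbf{a}}$ are the interiors of cells, of dimension $mn-\sum a_i$, of a CW structure on the one-point compactification of $\overline{\mathrm{Conf}}_n(\mathbb{R}^m)$ (the only other cell being the point at infinity, taken as basepoint). Its reduced mod-two cellular chain complex, with $e_{\mathbf{a}}$ regraded in degree $\sum a_i$, agrees in the limit $m\to\infty$ with $\mathrm{FN}_n^*$, and duality for manifolds (identifying reduced homology of the one-point compactification in degree $mn-k$ with $H^k(\overline{\mathrm{Conf}}_n(\mathbb{R}^m);\mathbb{F}_2)$) gives the identification. *)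

theory Defs
  imports "HOL-Analysis.Analysis" "HOL-Homology.Homology" "HOL-Combinatorics.Permutations"
    "HOL-Library.Z2" "HOL-Library.Function_Algebras"
begin

section \<open>Vector spaces over the field with two elements and cohomology\<close>

text \<open>
  A vector space over the field with two elements is an abelian group of exponent two. A linear map
  is a group homomorphism, and a linear combination is the sum of a finite subfamily, because the
  only coefficients are 0 and 1. The family \<open>f\<close> indexed by \<open>I\<close> is a basis if each element is a
  linear combination of it in exactly one way. This entails that \<open>f\<close> is injective on \<open>I\<close>.
\<close>
definition F2_basis :: "('g, 'x) monoid_scheme \<Rightarrow> 'i set \<Rightarrow> ('i \<Rightarrow> 'g) \<Rightarrow> bool" where
  "F2_basis G I f \<longleftrightarrow>
     f ` I \<subseteq> carrier G \<and>
     (\<forall>x \<in> carrier G. \<exists>!J. finite J \<and> J \<subseteq> I \<and> x = finprod G f J)"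

text \<open>
  Cochain complexes are given by the subgroups \<open>C k\<close> of an ambient additive group and the
  differentials \<open>d k\<close> from \<open>C k\<close> to \<open>C (Suc k)\<close>. There is nothing in negative degrees.
\<close>
definition cocycle_group :: "(nat \<Rightarrow> 'c::ab_group_add set) \<Rightarrow> (nat \<Rightarrow> 'c \<Rightarrow> 'c) \<Rightarrow> nat \<Rightarrow> 'c monoid" where
  "cocycle_group C d k = \<lparr>carrier = {c \<in> C k. d k c = 0}, monoid.mult = (+), monoid.one = 0\<rparr>"

definition coboundaries :: "(nat \<Rightarrow> 'c::ab_group_add set) \<Rightarrow> (nat \<Rightarrow> 'c \<Rightarrow> 'c) \<Rightarrow> nat \<Rightarrow> 'c set" where
  "coboundaries C d k = (case k of 0 \<Rightarrow> {0} | Suc j \<Rightarrow> d j ` C j)"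

definition cohom :: "(nat \<Rightarrow> 'c::ab_group_add set) \<Rightarrow> (nat \<Rightarrow> 'c \<Rightarrow> 'c) \<Rightarrow> nat \<Rightarrow> 'c set monoid" where
  "cohom C d k = cocycle_group C d k Mod coboundaries C d k"

definition cohom_class :: "(nat \<Rightarrow> 'c::ab_group_add set) \<Rightarrow> (nat \<Rightarrow> 'c \<Rightarrow> 'c) \<Rightarrow> nat \<Rightarrow> 'c \<Rightarrow> 'c set" where
  "cohom_class C d k c = coboundaries C d k #>\<^bsub>cocycle_group C d k\<^esub> c"


section \<open>The mod-two Fox-Neuwirth cochain complex\<close>

text \<open>Entries are indexed from 0, so that \<open>a ! p\<close> is the entry usually written with index \<open>p + 1\<close>.\<close>

type_synonym fn_cochain = "nat list \<Rightarrow>\<^sub>0 bit"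

abbreviation fn :: "nat list \<Rightarrow> fn_cochain" where
  "fn a \<equiv> Poly_Mapping.single a 1"

definition FN :: "nat \<Rightarrow> fn_cochain set" where
  "FN n = {c. \<forall>a \<in> Poly_Mapping.keys c. length a = n - 1}"

definition FN_deg :: "nat \<Rightarrow> nat \<Rightarrow> fn_cochain set" where
  "FN_deg n k = {c \<in> FN n. \<forall>a \<in> Poly_Mapping.keys c. sum_list a = k}"

text \<open>
  \<open>cut_blocks s xs\<close> cuts \<open>xs\<close> at each entry equal to \<open>s\<close>; the result has one more block than there
  are separators, and blocks may be empty. \<open>join_blocks s\<close> is its inverse.
\<close>
fun cut_blocks :: "nat \<Rightarrow> nat list \<Rightarrow> nat list list" where
  "cut_blocks s [] = [[]]"
| "cut_blocks s (x # xs) =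
     (if x = s then [] # cut_blocks s xs
      else (x # hd (cut_blocks s xs)) # tl (cut_blocks s xs))"

fun join_blocks :: "nat \<Rightarrow> nat list list \<Rightarrow> nat list" where
  "join_blocks s [] = []"
| "join_blocks s [b] = b"
| "join_blocks s (b # b' # bs) = b @ s # join_blocks s (b' # bs)"

text \<open>A \<open>(p,q)\<close>-shuffle \<open>\<sigma>\<close> sends the item at position \<open>j\<close> to position \<open>\<sigma> j\<close>.\<close>
definition shuffle_perms :: "nat \<Rightarrow> nat \<Rightarrow> (nat \<Rightarrow> nat) set" where
  "shuffle_perms p q =
     {\<sigma>. \<sigma> permutes {..<p + q} \<and> strict_mono_on {..<p} \<sigma> \<and> strict_mono_on {p..<p + q} \<sigma>}"

definition fn_delta :: "nat list \<Rightarrow> nat \<Rightarrow> fn_cochain" where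
  "fn_delta a i =
    (let l = a ! i;
         left = rev (takeWhile (\<lambda>x. l < x) (rev (take i a)));
         right = takeWhile (\<lambda>x. l < x) (drop (Suc i) a);
         before = take (i - length left) a;
         after = drop (Suc i + length right) a;
         blocks = cut_blocks (Suc l) (left @ [Suc l] @ right);
         N = length blocks;
         k = length (cut_blocks (Suc l) left)
     in \<Sum>\<sigma> \<in> shuffle_perms k (N - k).
          fn (before @ join_blocks (Suc l) (permute_list (inv_into UNIV \<sigma>) blocks) @ after))"

text \<open>Linear extension: the coefficient at each element of \<open>keys c\<close> is 1.\<close>
definition fn_diff :: "fn_cochain \<Rightarrow> fn_cochain" where
  "fn_diff c = (\<Sum>a \<in> Poly_Mapping.keys c. \<Sum>i < length a. fn_delta a i)"

definition H_FN :: "nat \<Rightarrow> nat \<Rightarrow> fn_cochain set monoid" where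
  "H_FN n k = cohom (FN_deg n) (\<lambda>_. fn_diff) k"

text \<open>The class of a (not necessarily homogeneous) cocycle in the direct sum of the \<open>H_FN n k\<close>.\<close>
definition fn_part :: "nat \<Rightarrow> fn_cochain \<Rightarrow> fn_cochain" where
  "fn_part k c = (\<Sum>a \<in> {a \<in> Poly_Mapping.keys c. sum_list a = k}. fn a)"

definition fn_class :: "nat \<Rightarrow> fn_cochain \<Rightarrow> nat \<Rightarrow> fn_cochain set" where
  "fn_class n c = (\<lambda>k. cohom_class (FN_deg n) (\<lambda>_. fn_diff) k (fn_part k c))"


section \<open>Configuration spaces and the classifying space of a symmetric group\<close>

definition ordered_conf :: "nat \<Rightarrow> nat \<Rightarrow> (nat \<Rightarrow> nat \<Rightarrow> real) topology" where
  "ordered_conf n m =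
     subtopology (product_topology (\<lambda>_. Euclidean_space m) {..<n}) {x. inj_on x {..<n}}"

definition conf_set :: "nat \<Rightarrow> nat \<Rightarrow> (nat \<Rightarrow> real) set set" where
  "conf_set n m = {S. card S = n \<and> finite S \<and> S \<subseteq> topspace (Euclidean_space m)}"

text \<open>The quotient topology.\<close>
definition conf :: "nat \<Rightarrow> nat \<Rightarrow> (nat \<Rightarrow> real) set topology" where
  "conf n m = topology (\<lambda>U. U \<subseteq> conf_set n m \<and>
     openin (ordered_conf n m) {x \<in> topspace (ordered_conf n m). x ` {..<n} \<in> U})"

lemma openin_conf:
  "openin (conf n m) U \<longleftrightarrow> U \<subseteq> conf_set n m \<and>
     openin (ordered_conf n m) {x \<in> topspace (ordered_conf n m). x ` {..<n} \<in> U}"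
proof -
  let ?q = "\<lambda>U. {x \<in> topspace (ordered_conf n m). x ` {..<n} \<in> U}"
  have "istopology (\<lambda>U. U \<subseteq> conf_set n m \<and> openin (ordered_conf n m) (?q U))"
    unfolding istopology_def
  proof (intro conjI allI impI; (elim conjE)?)
    fix S T assume "openin (ordered_conf n m) (?q S)" "openin (ordered_conf n m) (?q T)"
    then have "openin (ordered_conf n m) (?q S \<inter> ?q T)" by (rule openin_Int)
    moreover have "?q S \<inter> ?q T = ?q (S \<inter> T)" by auto
    ultimately show "openin (ordered_conf n m) (?q (S \<inter> T))" by simp
  next
    fix \<K> assume "\<forall>K\<in>\<K>. K \<subseteq> conf_set n m \<and> openin (ordered_conf n m) (?q K)"
    then have "openin (ordered_conf n m) (\<Union> (?q ` \<K>))" by (intro openin_Union) auto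
    moreover have "\<Union> (?q ` \<K>) = ?q (\<Union> \<K>)" by auto
    ultimately show "openin (ordered_conf n m) (?q (\<Union> \<K>))" by simp
  qed auto
  then show ?thesis unfolding conf_def by (simp add: topology_inverse')
qed

lemma topspace_conf: "topspace (conf n m) = conf_set n m"
proof -
  have "x ` {..<n} \<in> conf_set n m" if "x \<in> topspace (ordered_conf n m)" for x
    using that by (auto simp: ordered_conf_def conf_set_def card_image PiE_iff)
  then have "{x \<in> topspace (ordered_conf n m). x ` {..<n} \<in> conf_set n m} = topspace (ordered_conf n m)"
    by auto
  then have "openin (conf n m) (conf_set n m)" unfolding openin_conf by simp
  then show ?thesis
    by (metis openin_conf openin_subset openin_topspace subset_antisym)
qed

text \<open>The colimit topology on the union of the \<open>conf n m\<close> over all \<open>m\<close>.\<close>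
definition BS :: "nat \<Rightarrow> (nat \<Rightarrow> real) set topology" where
  "BS n = topology (\<lambda>U. U \<subseteq> (\<Union>m. conf_set n m) \<and> (\<forall>m. openin (conf n m) (U \<inter> conf_set n m)))"

lemma openin_BS:
  "openin (BS n) U \<longleftrightarrow>
     U \<subseteq> (\<Union>m. conf_set n m) \<and> (\<forall>m. openin (conf n m) (U \<inter> conf_set n m))"
proof -
  have "istopology (\<lambda>U. U \<subseteq> (\<Union>m. conf_set n m) \<and> (\<forall>m. openin (conf n m) (U \<inter> conf_set n m)))"
    unfolding istopology_def
  proof (intro conjI allI impI; (elim conjE)?)
    fix S T m assume "\<forall>m. openin (conf n m) (S \<inter> conf_set n m)"
      "\<forall>m. openin (conf n m) (T \<inter> conf_set n m)"
    then have "openin (conf n m) ((S \<inter> conf_set n m) \<inter> (T \<inter> conf_set n m))" by blast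
    moreover have "(S \<inter> conf_set n m) \<inter> (T \<inter> conf_set n m) = (S \<inter> T) \<inter> conf_set n m" by auto
    ultimately show "openin (conf n m) ((S \<inter> T) \<inter> conf_set n m)" by simp
  next
    fix \<K> m assume "\<forall>K\<in>\<K>. K \<subseteq> (\<Union>m. conf_set n m) \<and> (\<forall>m. openin (conf n m) (K \<inter> conf_set n m))"
    then have "openin (conf n m) (\<Union>K\<in>\<K>. K \<inter> conf_set n m)" by (intro openin_Union) auto
    moreover have "(\<Union>K\<in>\<K>. K \<inter> conf_set n m) = \<Union> \<K> \<inter> conf_set n m" by auto
    ultimately show "openin (conf n m) (\<Union> \<K> \<inter> conf_set n m)" by simp
  qed auto
  then show ?thesis unfolding BS_def by (simp add: topology_inverse')
qed

text \<open>Singular cochains with mod-two coefficients.\<close>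
type_synonym 'a cochain = "((nat \<Rightarrow> real) \<Rightarrow> 'a) \<Rightarrow> bit"

definition cochains :: "'a topology \<Rightarrow> nat \<Rightarrow> 'a cochain set" where
  "cochains X k = {\<phi>. \<forall>\<sigma>. \<not> singular_simplex k X \<sigma> \<longrightarrow> \<phi> \<sigma> = 0}"

definition coboundary :: "'a topology \<Rightarrow> nat \<Rightarrow> 'a cochain \<Rightarrow> 'a cochain" where
  "coboundary X k \<phi> =
     (\<lambda>\<sigma>. if singular_simplex (Suc k) X \<sigma> then \<Sum>i\<le>Suc k. \<phi> (singular_face (Suc k) i \<sigma>) else 0)"

definition H_sing :: "'a topology \<Rightarrow> nat \<Rightarrow> 'a cochain set monoid" where
  "H_sing X k = cohom (cochains X) (coboundary X) k"


section \<open>The cohomology of the Fox-Neuwirth complex and of the classifying space\<close>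

text \<open>
  Mod-two singular chains are represented by integral singular chains, considered modulo twice the
  integral chains. The next three predicates say, of an integral chain \<open>c\<close> of \<open>X\<close> and
  modulo two: \<open>c\<close> vanishes relative to \<open>A\<close>; \<open>c\<close> is a relative cycle of \<open>(X, A)\<close>; and \<open>c\<close> is a
  relative boundary of \<open>(X, A)\<close>.
\<close>
definition mod2_zero :: "nat \<Rightarrow> 'a topology \<Rightarrow> 'a set \<Rightarrow> 'a chain \<Rightarrow> bool" where
  "mod2_zero p X A c \<longleftrightarrow>
     (\<exists>r e. singular_chain p (subtopology X A) r \<and> singular_chain p X e \<and> c = r + frag_cmul 2 e)"

definition mod2_relcycle :: "nat \<Rightarrow> 'a topology \<Rightarrow> 'a set \<Rightarrow> 'a chain \<Rightarrow> bool" where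
  "mod2_relcycle p X A c \<longleftrightarrow> singular_chain p X c \<and> mod2_zero (p - 1) X A (chain_boundary p c)"

definition mod2_relboundary :: "nat \<Rightarrow> 'a topology \<Rightarrow> 'a set \<Rightarrow> 'a chain \<Rightarrow> bool" where
  "mod2_relboundary p X A c \<longleftrightarrow>
     (\<exists>d. singular_chain (Suc p) X d \<and> mod2_zero p X A (chain_boundary (Suc p) d - c))"

text \<open>\<open>\<mu>\<close> represents the mod-two fundamental class along \<open>K\<close> of the \<open>d\<close>-manifold \<open>M\<close>.\<close>
definition fundamental_along :: "nat \<Rightarrow> 'a topology \<Rightarrow> 'a set \<Rightarrow> 'a chain \<Rightarrow> bool" where
  "fundamental_along d M K \<mu> \<longleftrightarrow>
     mod2_relcycle d M (topspace M - K) \<mu> \<and>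
     (\<forall>x \<in> K. \<not> mod2_relboundary d M (topspace M - {x}) \<mu>)"

text \<open>
  Cap product of a \<open>d\<close>-chain with a \<open>k\<close>-cochain: \<open>\<phi>\<close> is evaluated on the front face, spanned
  by the vertices \<open>0..k\<close>, and the back face, spanned by the vertices \<open>k..d\<close>, remains.
\<close>
definition cap :: "nat \<Rightarrow> nat \<Rightarrow> 'a chain \<Rightarrow> 'a cochain \<Rightarrow> 'a chain" where
  "cap d k c \<phi> = frag_extend
     (\<lambda>\<sigma>. if \<phi> (restrict \<sigma> (standard_simplex k)) = 1
          then frag_of (restrict (\<lambda>x. \<sigma> (\<lambda>i. if i < k then 0 else x (i - k))) (standard_simplex (d - k)))
          else 0) c"

text \<open>
  Duality for the \<open>d\<close>-manifold \<open>M\<close>, between the class of the \<open>k\<close>-cocycle \<open>\<phi>\<close> and the reduced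
  homology class of the one-point compactification given by the cycle \<open>w\<close> relative to the
  point at infinity \<open>None\<close>: for every compact set \<open>K\<close> of \<open>M\<close>, \<open>w\<close> agrees relative to the complement
  of \<open>K\<close> with the cap product of \<open>\<phi>\<close> and the fundamental class along \<open>K\<close>.
\<close>
definition dual_classes :: "nat \<Rightarrow> 'a topology \<Rightarrow> nat \<Rightarrow> 'a cochain \<Rightarrow> 'a option chain \<Rightarrow> bool" where
  "dual_classes d M k \<phi> w \<longleftrightarrow>
     (\<forall>K. compactin M K \<longrightarrow>
        (\<exists>\<mu>. fundamental_along d M K \<mu> \<and>
             mod2_relboundary (d - k) (Alexandroff_compactification M)
               (topspace (Alexandroff_compactification M) - Some ` K)
               (chain_map (d - k) Some (cap d k \<mu> \<phi>) - w)))"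

definition dict_less :: "(nat \<Rightarrow> real) \<Rightarrow> (nat \<Rightarrow> real) \<Rightarrow> bool" where
  "dict_less x y \<longleftrightarrow> (\<exists>j. (\<forall>i<j. x i = y i) \<and> x j < y j)"

definition fn_cell :: "nat \<Rightarrow> nat \<Rightarrow> nat list \<Rightarrow> (nat \<Rightarrow> real) set set" where
  "fn_cell n m a = {S \<in> conf_set n m. \<exists>x. S = x ` {..<n} \<and>
     (\<forall>p < n - 1. dict_less (x p) (x (Suc p)) \<and>
        (\<forall>j < a ! p. x p j = x (Suc p) j) \<and> x p (a ! p) \<noteq> x (Suc p) (a ! p))}"

definition fn_cell_indices :: "nat \<Rightarrow> nat \<Rightarrow> nat list set" where
  "fn_cell_indices n m = {a. length a = n - 1 \<and> (\<forall>v \<in> set a. v < m)}"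

text \<open>The \<open>q\<close>-skeleton; the cell indexed by \<open>a\<close> has dimension \<open>m * n - sum_list a\<close>.\<close>
definition fn_skeleton :: "nat \<Rightarrow> nat \<Rightarrow> nat \<Rightarrow> (nat \<Rightarrow> real) set option topology" where
  "fn_skeleton n m q = subtopology (Alexandroff_compactification (conf n m))
     (insert None (Some ` (\<Union>a \<in> {a \<in> fn_cell_indices n m. m * n - sum_list a \<le> q}. fn_cell n m a)))"

text \<open>
  \<open>w\<close> is a cycle of the \<open>q\<close>-skeleton relative to the point at infinity, for \<open>q = m * n - k\<close>, whose image in
  the group of cellular \<open>q\<close>-chains is the sum of the cells that occur in \<open>c\<close>. The coefficient of
  a \<open>q\<close>-cell in that image is the class of \<open>w\<close> in the homology (of order two) of the \<open>q\<close>-skeleton relative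
  to the complement of the open cell.
\<close>
definition fn_cellular_cycle ::
  "nat \<Rightarrow> nat \<Rightarrow> nat \<Rightarrow> fn_cochain \<Rightarrow> (nat \<Rightarrow> real) set option chain \<Rightarrow> bool" where
  "fn_cellular_cycle n m k c w \<longleftrightarrow>
     (let q = m * n - k; X = fn_skeleton n m q in
       mod2_relcycle q X {None} w \<and>
       (\<forall>a \<in> fn_cell_indices n m. sum_list a = k \<longrightarrow>
          (a \<in> Poly_Mapping.keys c \<longleftrightarrow>
             \<not> mod2_relboundary q X (topspace X - Some ` fn_cell n m a) w)))"

text \<open>
  The identification of the cohomology of the Fox-Neuwirth complex with that of \<open>BS n\<close>, for \<open>n \<ge> 1\<close>,
  as an isomorphism in each degree: the class of a cocycle \<open>c\<close> corresponds to the class of a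
  singular cocycle \<open>\<phi>\<close> if, for all large \<open>m\<close>, the restriction of \<open>\<phi>\<close> to \<open>conf n m\<close> is dual to
  the homology class of the cellular cycle \<open>c\<close>. Restricting a cochain to a subspace does not need an
  operation here, since singular simplices of \<open>conf n m\<close> are singular simplices of \<open>BS n\<close>.
\<close>
definition FN_identification ::
  "nat \<Rightarrow> (nat \<Rightarrow> fn_cochain set \<Rightarrow> (nat \<Rightarrow> real) set cochain set) \<Rightarrow> bool" where
  "FN_identification n \<Phi> \<longleftrightarrow>
     (\<forall>k. \<Phi> k \<in> iso (H_FN n k) (H_sing (BS n) k) \<and>
        (\<forall>c \<in> FN_deg n k. fn_diff c = 0 \<longrightarrow>
           (\<forall>\<phi> \<in> \<Phi> k (cohom_class (FN_deg n) (\<lambda>_. fn_diff) k c).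
              \<forall>\<^sub>F m in sequentially.
                \<exists>w. fn_cellular_cycle n m k c w \<and> dual_classes (m * n) (conf n m) k \<phi> w)))"

end

theory Submission
  imports Defs
begin

text \<open>
  The basis sequences of length three fall into three classes. A matching pairs each sequence
  \<open>a\<close> of the first class with a sequence \<open>\<mu> a\<close> of the second one, roughly by raising the
  smallest entry of \<open>a\<close> and moving it from the left to the right. For a suitable rank,
  \<open>\<delta> a\<close> is \<open>\<mu> a\<close> plus sequences that have smaller rank or are in the first class. The third class
  consists of \<open>[x, 0, 0]\<close> with \<open>x > 0\<close>, of \<open>[x, 0, z]\<close> with \<open>0 < z < x\<close>, and of
  \<open>[x, y, x]\<close> with \<open>y \<le> x\<close>; these are the leading terms of the given cocycles. By
  unitriangularity, the first class, its image under \<open>\<delta>\<close> and the given cocycles together form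
  a basis of the complex. As \<open>\<delta>\<close> is injective on the span of the first class and vanishes on
  the rest, the cocycles are the coboundaries plus the span of the given ones, and this sum is direct.
\<close>

section \<open>Shuffles\<close>

text \<open>Splitting \<open>zs\<close> at \<open>j\<close> puts \<open>zs ! i\<close> into the
  filtered prefix, and sortedness relates the elements of the prefix to
  \<open>zs ! j\<close>.\<close>

lemma sorted_wrt_filter_nth:
  assumes "sorted_wrt R (filter P zs)" "i < j" "j < length zs" "P (zs ! i)" "P (zs ! j)"
  shows "R (zs ! i) (zs ! j)"
proof -
  have "zs = take j zs @ zs ! j # drop (Suc j) zs"
    using assms(3) by (rule id_take_nth_drop)
  then have "sorted_wrt R (filter P (take j zs) @ zs ! j # filter P (drop (Suc j) zs))"
    using assms(1,5) by (metis filter.simps(2) filter_append)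
  moreover have "zs ! i \<in> set (filter P (take j zs))"
    using assms(2-4) by (auto simp: in_set_conv_nth intro!: exI[of _ i])
  ultimately show ?thesis by (auto simp: sorted_wrt_append)
qed

text \<open>The item \<open>j\<close> stands at position \<open>\<sigma> j\<close> of the list of
  inverse values. As \<open>\<sigma>\<close> is increasing on \<open>A\<close>, the items of
  \<open>A\<close> stand there in increasing order, and a strictly increasing list is determined by
  its set.\<close>

lemma filter_map_inv_upt:
  assumes \<sigma>: "\<sigma> permutes {..<n}" and A: "A \<subseteq> {..<n}" and mono: "strict_mono_on A \<sigma>"
    and xs: "sorted_wrt (<) xs" "set xs = A"
  shows "filter (\<lambda>i. i \<in> A) (map (inv_into UNIV \<sigma>) [0..<n]) = xs"
proof (rule strict_sorted_equal)
  have inv: "inv_into UNIV \<sigma> permutes {..<n}" using \<sigma> by (rule permutes_inv)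
  show "sorted_wrt (<) (filter (\<lambda>i. i \<in> A) (map (inv_into UNIV \<sigma>) [0..<n]))"
    unfolding filter_map sorted_wrt_map
  proof (rule sorted_wrt_mono_rel)
    show "sorted_wrt (<) (filter ((\<lambda>i. i \<in> A) \<circ> inv_into UNIV \<sigma>) [0..<n])"
      by (simp add: sorted_wrt_filter)
    fix i j assume "i \<in> set (filter ((\<lambda>i. i \<in> A) \<circ> inv_into UNIV \<sigma>) [0..<n])"
      "j \<in> set (filter ((\<lambda>i. i \<in> A) \<circ> inv_into UNIV \<sigma>) [0..<n])" "i < j"
    then show "inv_into UNIV \<sigma> i < inv_into UNIV \<sigma> j"
      using mono \<sigma> by (auto simp: strict_mono_on_less permutes_inverses(1)[OF \<sigma>]
          dest: strict_mono_on_less[OF mono])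
  qed
  show "set (filter (\<lambda>i. i \<in> A) (map (inv_into UNIV \<sigma>) [0..<n])) = set xs"
    using permutes_image[OF inv] xs A by (auto simp: lessThan_atLeast0)
qed (use xs in simp)

text \<open>Reading the items in the order of their new positions turns a shuffle permutation into
  an interleaving of two index lists. Sums over permutations thus become sums over the recursively
  defined \<open>shuffles\<close>, which can be computed.\<close>

lemma bij_betw_shuffle_perms:
  "bij_betw (\<lambda>\<sigma>. map (inv_into UNIV \<sigma>) [0..<p + q]) (shuffle_perms p q) (shuffles [0..<p] [p..<p + q])"
  unfolding bij_betw_def
proof (intro conjI inj_onI equalityI subsetI)
  fix \<sigma> \<sigma>' assume \<sigma>: "\<sigma> \<in> shuffle_perms p q" and \<sigma>': "\<sigma>' \<in> shuffle_perms p q"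
    and eq: "map (inv_into UNIV \<sigma>) [0..<p + q] = map (inv_into UNIV \<sigma>') [0..<p + q]"
  have perm: "\<sigma> permutes {..<p + q}" "\<sigma>' permutes {..<p + q}"
    using \<sigma> \<sigma>' by (auto simp: shuffle_perms_def)
  have "inv_into UNIV \<sigma> i = inv_into UNIV \<sigma>' i" for i
  proof (cases "i < p + q")
    case True
    then show ?thesis using eq by simp
  next
    case False
    then show ?thesis using permutes_inv[OF perm(1)] permutes_inv[OF perm(2)]
      by (simp add: permutes_not_in)
  qed
  then have "inv_into UNIV \<sigma> = inv_into UNIV \<sigma>'" by blast
  then show "\<sigma> = \<sigma>'" using perm by (metis inv_inv_eq permutes_bij)
next
  fix zs assume "zs \<in> (\<lambda>\<sigma>. map (inv_into UNIV \<sigma>) [0..<p + q]) ` shuffle_perms p q"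
  then obtain \<sigma> where zs: "zs = map (inv_into UNIV \<sigma>) [0..<p + q]" and \<sigma>: "\<sigma> permutes {..<p + q}"
    "strict_mono_on {..<p} \<sigma>" "strict_mono_on {p..<p + q} \<sigma>"
    by (auto simp: shuffle_perms_def)
  have set: "set zs = {..<p + q}"
    unfolding zs using permutes_image[OF permutes_inv[OF \<sigma>(1)]] by (simp add: lessThan_atLeast0)
  \<comment> \<open>A list is an interleaving of the entries satisfying a predicate with the other
    ones; monotonicity on the two index ranges identifies both sublists.\<close>
  have "filter (\<lambda>i. i < p) zs = [0..<p]"
    using filter_map_inv_upt[OF \<sigma>(1) _ \<sigma>(2), of "[0..<p]"] unfolding zs
    by (simp add: lessThan_atLeast0)
  moreover have "filter (\<lambda>i. \<not> i < p) zs = filter (\<lambda>i. i \<in> {p..<p + q}) zs"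
    by (rule filter_cong[OF refl]) (auto simp: set)
  moreover have "filter (\<lambda>i. i \<in> {p..<p + q}) zs = [p..<p + q]"
    using filter_map_inv_upt[OF \<sigma>(1) _ \<sigma>(3), of "[p..<p + q]"] unfolding zs
    by (simp add: subset_iff)
  ultimately show "zs \<in> shuffles [0..<p] [p..<p + q]"
    using partition_in_shuffles[of zs "\<lambda>i. i < p"] by simp
next
  fix zs assume zs: "zs \<in> shuffles [0..<p] [p..<p + q]"
  define n where "n = p + q"
  \<comment> \<open>\<open>\<tau>\<close> has one-line notation \<open>zs\<close>, continued by the
    identity. Its inverse sends an item to its position in \<open>zs\<close> and will be the
    shuffle.\<close>
  define \<tau> where "\<tau> i = (if i < n then zs ! i else i)" for i
  have len: "length zs = n" using length_shuffles[OF zs] by (simp add: n_def)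
  have set: "set zs = {..<n}"
    using set_shuffles[OF zs] by (simp add: n_def lessThan_atLeast0 ivl_disj_un_two(3))
  have dist: "distinct zs" by (rule distinct_disjoint_shuffles[OF _ _ _ zs]) auto
  have "bij_betw ((!) zs) {..<n} {..<n}"
    by (rule bij_betw_nth[OF dist]) (simp_all only: len set)
  then have "bij_betw \<tau> {..<n} {..<n}"
    by (rule bij_betw_cong[THEN iffD1, rotated]) (simp add: \<tau>_def)
  then have \<tau>: "\<tau> permutes {..<n}" by (rule bij_imp_permutes) (simp add: \<tau>_def)
  have mono: "strict_mono_on A (inv_into UNIV \<tau>)" if A: "A \<subseteq> {..<n}" and "sorted_wrt (<) (filter (\<lambda>i. i \<in> A) zs)" for A
  proof (rule strict_mono_onI, rule ccontr)
    fix r s assume rs: "r \<in> A" "s \<in> A" "r < s" "\<not> inv_into UNIV \<tau> r < inv_into UNIV \<tau> s"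
    have inv: "inv_into UNIV \<tau> permutes {..<n}" using \<tau> by (rule permutes_inv)
    have lt: "inv_into UNIV \<tau> r < n" "inv_into UNIV \<tau> s < n"
      using rs A permutes_in_image[OF inv] by auto
    have nth: "zs ! inv_into UNIV \<tau> r = r" "zs ! inv_into UNIV \<tau> s = s"
      using permutes_inverses(1)[OF \<tau>] lt by (metis \<tau>_def)+
    have "inv_into UNIV \<tau> s \<noteq> inv_into UNIV \<tau> r" using rs(3) nth by (metis less_irrefl)
    then have "inv_into UNIV \<tau> s < inv_into UNIV \<tau> r" using rs by simp
    then have "zs ! inv_into UNIV \<tau> s < zs ! inv_into UNIV \<tau> r"
      using lt rs nth len by (intro sorted_wrt_filter_nth[OF that(2)]) simp_all
    then show False using nth rs by simp
  qed
  have "filter (\<lambda>i. i \<in> set [0..<p]) zs = [0..<p]"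
    by (rule filter_shuffles_disjoint1(1)[OF _ zs]) auto
  then have 1: "strict_mono_on {..<p} (inv_into UNIV \<tau>)"
    by (intro mono) (simp_all add: lessThan_atLeast0 n_def)
  have "filter (\<lambda>i. i \<in> set [p..<p + q]) zs = [p..<p + q]"
    by (rule filter_shuffles_disjoint2(1)[OF _ zs]) auto
  then have 2: "strict_mono_on {p..<p + q} (inv_into UNIV \<tau>)"
    by (intro mono) (auto simp: n_def)
  have "inv_into UNIV \<tau> \<in> shuffle_perms p q"
    using permutes_inv[OF \<tau>] 1 2 by (simp add: shuffle_perms_def n_def)
  moreover have "map \<tau> [0..<p + q] = zs"
    using len by (intro nth_equalityI) (simp_all add: \<tau>_def n_def)
  then have "map (inv_into UNIV (inv_into UNIV \<tau>)) [0..<p + q] = zs"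
    using permutes_bij[OF \<tau>] by (simp only: inv_inv_eq)
  ultimately show "zs \<in> (\<lambda>\<sigma>. map (inv_into UNIV \<sigma>) [0..<p + q]) ` shuffle_perms p q" by force
qed

text \<open>Indices are interleaved rather than blocks. This keeps equal blocks apart, so that
  multiplicities survive although \<open>shuffles\<close> yields a set.\<close>

lemma sum_shuffle_perms:
  assumes "length bs = p + q"
  shows "(\<Sum>\<sigma> \<in> shuffle_perms p q. F (permute_list (inv_into UNIV \<sigma>) bs)) =
    (\<Sum>zs \<in> shuffles [0..<p] [p..<p + q]. F (map ((!) bs) zs))"
  by (subst sum.reindex_bij_betw[OF bij_betw_shuffle_perms, symmetric])
    (simp add: permute_list_def assms o_def)

section \<open>The differential on sequences of length three\<close>

lemma add_self_F2: "c + c = (0 :: 'a \<Rightarrow>\<^sub>0 bit)"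
  by (rule poly_mapping_eqI) (simp add: lookup_add)

lemma add_left_self_F2: "c + (c + c') = (c' :: 'a \<Rightarrow>\<^sub>0 bit)"
  by (simp add: add_self_F2 flip: add.assoc)

text \<open>The sum over the three shuffles that place one block \<open>[r]\<close> among two empty
  blocks, with separators \<open>q\<close>.\<close>

definition fn_arr :: "nat \<Rightarrow> nat \<Rightarrow> fn_cochain" where
  "fn_arr q r = fn [q, q, r] + fn [q, r, q] + fn [r, q, q]"


lemma length_cut_blocks: "length (cut_blocks s xs) = Suc (count_list xs s)"
  by (induction xs) auto

text \<open>There is one more block than separators, so \<open>k\<close> does not exceed the number
  of blocks. On explicit sequences this form can be evaluated by simplification.\<close>

lemma fn_delta_shuffles:
  "fn_delta a i =
    (let l = a ! i;
         left = rev (takeWhile (\<lambda>x. l < x) (rev (take i a)));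
         right = takeWhile (\<lambda>x. l < x) (drop (Suc i) a);
         before = take (i - length left) a;
         after = drop (Suc i + length right) a;
         blocks = cut_blocks (Suc l) (left @ [Suc l] @ right);
         k = length (cut_blocks (Suc l) left)
     in \<Sum>zs \<in> shuffles [0..<k] [k..<length blocks].
          fn (before @ join_blocks (Suc l) (map ((!) blocks) zs) @ after))"
  unfolding fn_delta_def Let_def
  by (subst sum_shuffle_perms) (simp_all add: length_cut_blocks)

text \<open>Only the comparisons of \<open>y\<close> and \<open>z\<close> with \<open>x\<close> and
  with the separator \<open>Suc x\<close> matter. If all blocks are empty, all terms agree and the
  number of shuffles counts modulo two: it is 2, 3 or 4 for one, two or three separators.\<close>

lemma fn_delta_first:
  "fn_delta [x, y, z] 0 =
    (if y \<le> x then 0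
     else if z \<le> x then (if y = Suc x then fn [y, y, z] else fn [Suc x, y, z] + fn [y, Suc x, z])
     else if y = Suc x then (if z = Suc x then 0 else fn [y, z, y])
     else if z = Suc x then fn [z, y, z]
     else fn [Suc x, y, z] + fn [y, z, Suc x])"
  by (cases "y \<le> x"; cases "z \<le> x"; cases "y = Suc x"; cases "z = Suc x";
    simp add: fn_delta_shuffles not_le image_Un add_self_F2 add_left_self_F2 add_ac)

text \<open>The variables are named from right to left, so that this is the mirror image of the
  formula for the first position.\<close>

lemma fn_delta_last:
  "fn_delta [z, y, x] (Suc (Suc 0)) =
    (if y \<le> x then 0
     else if z \<le> x then (if y = Suc x then fn [z, y, y] else fn [z, y, Suc x] + fn [z, Suc x, y])
     else if y = Suc x then (if z = Suc x then 0 else fn [y, z, y])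
     else if z = Suc x then fn [z, y, z]
     else fn [z, y, Suc x] + fn [Suc x, z, y])"
  by (cases "y \<le> x"; cases "z \<le> x"; cases "y = Suc x"; cases "z = Suc x";
    simp add: fn_delta_shuffles not_le image_Un add_self_F2 add_left_self_F2 add_ac)

text \<open>Here the run may extend to both sides. Three separators give six shuffles of four empty
  blocks, which cancel; one neighbour equal to the separator and a larger one on the other side give
  three different arrangements.\<close>

lemma fn_delta_middle:
  "fn_delta [x, y, z] (Suc 0) =
    (if x \<le> y \<and> z \<le> y then 0
     else if z \<le> y then (if x = Suc y then fn [x, x, z] else fn [x, Suc y, z] + fn [Suc y, x, z])
     else if x \<le> y then (if z = Suc y then fn [x, z, z] else fn [x, Suc y, z] + fn [x, z, Suc y])
     else if x = Suc y \<and> z = Suc y then 0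
     else if x = Suc y then fn_arr x z
     else if z = Suc y then fn_arr z x
     else fn [x, Suc y, z] + fn [z, Suc y, x])"
  by (cases "x \<le> y"; cases "z \<le> y"; cases "x = Suc y"; cases "z = Suc y";
    simp add: fn_delta_shuffles not_le image_Un Let_def fn_arr_def add_self_F2 add_left_self_F2 add_ac)

section \<open>Linear algebra over the field with two elements\<close>

definition F2_lin :: "('a \<Rightarrow> 'b::comm_monoid_add) \<Rightarrow> ('a \<Rightarrow>\<^sub>0 bit) \<Rightarrow> 'b" where
  "F2_lin v c = (\<Sum>a \<in> Poly_Mapping.keys c. v a)"

definition F2_ind :: "'a set \<Rightarrow> 'a \<Rightarrow>\<^sub>0 bit" where
  "F2_ind J = (\<Sum>a \<in> J. Poly_Mapping.single a 1)"

lemma keys_F2_ind [simp]: "finite J \<Longrightarrow> Poly_Mapping.keys (F2_ind J) = J"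
  by (auto simp: F2_ind_def in_keys_iff lookup_sum lookup_single when_def split: if_splits)

lemma F2_lin_ind: "finite J \<Longrightarrow> F2_lin v (F2_ind J) = sum v J"
  by (simp add: F2_lin_def)

lemma F2_eqI: "Poly_Mapping.keys c = Poly_Mapping.keys c' \<Longrightarrow> c = (c' :: 'a \<Rightarrow>\<^sub>0 bit)"
  by (rule poly_mapping_eqI) (metis bit_not_zero_iff in_keys_iff)

lemma F2_ind_keys [simp]: "F2_ind (Poly_Mapping.keys c) = c"
  by (rule F2_eqI) simp

lemma keys_add_F2:
  "Poly_Mapping.keys (c + c' :: 'a \<Rightarrow>\<^sub>0 bit) =
    (Poly_Mapping.keys c - Poly_Mapping.keys c') \<union> (Poly_Mapping.keys c' - Poly_Mapping.keys c)"
  by (auto simp: in_keys_iff lookup_add)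

lemma F2_add_eq_0_iff: "c + c' = 0 \<longleftrightarrow> c = (c' :: 'a \<Rightarrow>\<^sub>0 bit)"
  by (metis add_left_self_F2 add_self_F2 add_0_right)

lemma F2_lin_0 [simp]: "F2_lin v 0 = 0"
  by (simp add: F2_lin_def)

lemma F2_lin_single [simp]: "F2_lin v (Poly_Mapping.single a 1) = v a"
  by (simp add: F2_lin_def)

text \<open>The support of a sum is the symmetric difference of the supports; what comes from the
  common part occurs twice and cancels.\<close>

lemma F2_lin_add [simp]: "F2_lin v (c + c') = F2_lin v c + F2_lin v c'"
  for v :: "'a \<Rightarrow> 'b \<Rightarrow>\<^sub>0 bit"
proof -
  let ?K = "Poly_Mapping.keys c" and ?K' = "Poly_Mapping.keys c'"
  have "F2_lin v (c + c') = sum v (?K - ?K') + sum v (?K' - ?K)"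
    unfolding F2_lin_def keys_add_F2 by (rule sum.union_disjoint) auto
  moreover have "sum v ?K = sum v (?K - ?K') + sum v (?K \<inter> ?K')"
    "sum v ?K' = sum v (?K' - ?K) + sum v (?K \<inter> ?K')"
    using sum.Int_Diff[of ?K v ?K'] sum.Int_Diff[of ?K' v ?K] by (simp_all add: add_ac Int_commute)
  ultimately show ?thesis
    by (simp add: F2_lin_def add_ac add_self_F2 add_left_self_F2)
qed

lemma F2_lin_sum: "F2_lin v (sum f I) = (\<Sum>i \<in> I. F2_lin v (f i))"
  for v :: "'a \<Rightarrow> 'b \<Rightarrow>\<^sub>0 bit"
  by (induction I rule: infinite_finite_induct) simp_all

lemma F2_lin_lin: "F2_lin v (F2_lin w c) = F2_lin (\<lambda>a. F2_lin v (w a)) c"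
  for v :: "'a \<Rightarrow> 'b \<Rightarrow>\<^sub>0 bit"
  by (simp add: F2_lin_def[of w] F2_lin_sum) (simp add: F2_lin_def)

lemma keys_F2_lin: "Poly_Mapping.keys (F2_lin v c) \<subseteq> (\<Union>a \<in> Poly_Mapping.keys c. Poly_Mapping.keys (v a))"
  unfolding F2_lin_def by (rule keys_sum)

lemma F2_lin_cong:
  "(\<And>a. a \<in> Poly_Mapping.keys c \<Longrightarrow> v a = w a) \<Longrightarrow> F2_lin v c = F2_lin w c"
  unfolding F2_lin_def by (rule sum.cong) auto

section \<open>Unitriangular families over the field with two elements\<close>

locale F2_unitriangular =
  fixes S :: "'a set" and v :: "'a \<Rightarrow> 'a \<Rightarrow>\<^sub>0 bit" and r :: "'a \<Rightarrow> nat"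
  assumes unitriangular:
    "a \<in> S \<Longrightarrow> \<exists>w. v a = Poly_Mapping.single a 1 + w \<and> (\<forall>b \<in> Poly_Mapping.keys w. b \<in> S \<and> r b < r a)"
begin

text \<open>A key \<open>a\<close> of maximal rank survives: the other keys contribute only
  themselves and sequences of rank below that of \<open>a\<close>, so the coefficient at
  \<open>a\<close> is 1.\<close>

lemma F2_lin_inj:
  assumes c: "Poly_Mapping.keys c \<subseteq> S" and 0: "F2_lin v c = 0"
  shows "c = 0"
proof (rule ccontr)
  assume "c \<noteq> 0"
  then have "Poly_Mapping.keys c \<noteq> {}" by simp
  then obtain a where a: "a \<in> Poly_Mapping.keys c" and max: "\<forall>b \<in> Poly_Mapping.keys c. r b \<le> r a"
    using obtains_MAX[of "Poly_Mapping.keys c" r] Max_ge[of "r ` Poly_Mapping.keys c"]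
    by (metis finite_imageI finite_keys imageI)
  have lookup: "Poly_Mapping.lookup (v b) a = (if b = a then 1 else 0)" if b: "b \<in> Poly_Mapping.keys c" for b
  proof -
    obtain w where w: "v b = Poly_Mapping.single b 1 + w" "\<forall>b' \<in> Poly_Mapping.keys w. r b' < r b"
      using unitriangular[OF subsetD[OF c b]] by blast
    then have "a \<notin> Poly_Mapping.keys w" using max b by (meson leD)
    then show ?thesis by (auto simp: w(1) lookup_add lookup_single in_keys_iff when_def)
  qed
  have "Poly_Mapping.lookup (F2_lin v c) a = (\<Sum>b \<in> Poly_Mapping.keys c. if b = a then 1 else 0)"
    unfolding F2_lin_def lookup_sum by (rule sum.cong) (simp_all add: lookup)
  then show False using a 0 by simp
qed

text \<open>By induction on the rank each generator is hit, since it differs from \<open>v a\<close>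
  by generators of smaller rank; the preimages are then extended linearly.\<close>

lemma F2_lin_surj:
  assumes "Poly_Mapping.keys c \<subseteq> S"
  obtains e where "Poly_Mapping.keys e \<subseteq> S" "F2_lin v e = c"
proof -
  have "\<exists>e. Poly_Mapping.keys e \<subseteq> S \<and> F2_lin v e = Poly_Mapping.single a 1" if "a \<in> S" for a
    using that
  proof (induction a rule: measure_induct_rule[of r])
    case (less a)
    obtain w where w: "v a = Poly_Mapping.single a 1 + w"
      "\<forall>b \<in> Poly_Mapping.keys w. b \<in> S \<and> r b < r a"
      using unitriangular[OF less.prems] by blast
    have "\<forall>b \<in> Poly_Mapping.keys w. \<exists>e. Poly_Mapping.keys e \<subseteq> S \<and> F2_lin v e = Poly_Mapping.single b 1"
      using less.IH w(2) by blast
    then obtain E where E: "\<And>b. b \<in> Poly_Mapping.keys w \<Longrightarrow> Poly_Mapping.keys (E b) \<subseteq> S"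
      "\<And>b. b \<in> Poly_Mapping.keys w \<Longrightarrow> F2_lin v (E b) = Poly_Mapping.single b 1"
      by metis
    \<comment> \<open>The generator is \<open>v a\<close> minus \<open>w\<close>, and subtraction is
      addition here.\<close>
    let ?e = "Poly_Mapping.single a 1 + (\<Sum>b \<in> Poly_Mapping.keys w. E b)"
    have "(\<Sum>b \<in> Poly_Mapping.keys w. F2_lin v (E b)) = w"
      using E(2) by (subst F2_ind_keys[of w, symmetric], subst F2_ind_def) (simp cong: sum.cong)
    then have "F2_lin v ?e = Poly_Mapping.single a 1"
      by (simp add: F2_lin_sum w(1) add.assoc add_self_F2)
    moreover have "Poly_Mapping.keys (\<Sum>b \<in> Poly_Mapping.keys w. E b) \<subseteq> S"
      using E(1) by (intro order_trans[OF keys_sum] UN_least)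
    then have "Poly_Mapping.keys ?e \<subseteq> S"
      using less.prems by (auto simp: keys_add_F2)
    ultimately show ?case by blast
  qed
  then obtain E where E: "\<And>a. a \<in> S \<Longrightarrow> Poly_Mapping.keys (E a) \<subseteq> S"
    "\<And>a. a \<in> S \<Longrightarrow> F2_lin v (E a) = Poly_Mapping.single a 1" by metis
  show thesis
  proof
    show "Poly_Mapping.keys (F2_lin E c) \<subseteq> S"
      using keys_F2_lin[of E c] E(1) assms by blast
    have "F2_lin v (F2_lin E c) = F2_lin (\<lambda>a. Poly_Mapping.single a 1) c"
      unfolding F2_lin_lin using E(2) assms by (intro F2_lin_cong) auto
    then show "F2_lin v (F2_lin E c) = c"
      by (metis F2_ind_def F2_ind_keys F2_lin_def)
  qed
qed

end

text \<open>
  An algebraic discrete Morse matching: \<open>\<nu>\<close> pairs each generator in \<open>Y\<close> with one in \<open>X\<close> whose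
  differential it leads, and the unmatched generators \<open>Z\<close> lead cocycles, so that no
  differential is left on \<open>Z\<close>.
\<close>
locale F2_matching =
  fixes X Y Z :: "'a set" and D b :: "'a \<Rightarrow> 'a \<Rightarrow>\<^sub>0 bit" and \<nu> :: "'a \<Rightarrow> 'a" and r :: "'a \<Rightarrow> nat"
  assumes disjoint: "X \<inter> Y = {}" "X \<inter> Z = {}" "Y \<inter> Z = {}"
    and \<nu>: "bij_betw \<nu> Y X"
    and leading_D: "a \<in> Y \<Longrightarrow> \<exists>w. D (\<nu> a) = Poly_Mapping.single a 1 + w \<and>
      (\<forall>a' \<in> Poly_Mapping.keys w. a' \<in> X \<union> Y \<union> Z \<and> r a' < r a)"
    and leading_b: "a \<in> Z \<Longrightarrow> \<exists>w. b a = Poly_Mapping.single a 1 + w \<and>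
      (\<forall>a' \<in> Poly_Mapping.keys w. a' \<in> X \<union> Y \<union> Z \<and> r a' < r a)"
    and D_D: "a \<in> X \<Longrightarrow> F2_lin D (D a) = 0"
    and D_b: "a \<in> Z \<Longrightarrow> F2_lin D (b a) = 0"
begin

text \<open>Each vector is indexed by its leading term. In this basis the differential sends the
  vector at \<open>\<nu> a\<close> to the vector at \<open>a\<close>, for \<open>a\<close> in
  \<open>Y\<close>, and kills the vectors indexed by \<open>Y\<close> and \<open>Z\<close>.\<close>

definition adapted :: "'a \<Rightarrow> 'a \<Rightarrow>\<^sub>0 bit" where
  "adapted a = (if a \<in> X then Poly_Mapping.single a 1 else if a \<in> Y then D (\<nu> a) else b a)"

sublocale F2_unitriangular "X \<union> Y \<union> Z" adapted r
proof
  fix a assume "a \<in> X \<union> Y \<union> Z"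
  then consider "a \<in> X" | "a \<in> Y" | "a \<in> Z" by blast
  then show "\<exists>w. adapted a = Poly_Mapping.single a 1 + w \<and>
      (\<forall>a' \<in> Poly_Mapping.keys w. a' \<in> X \<union> Y \<union> Z \<and> r a' < r a)"
  proof cases
    case 1
    then show ?thesis by (intro exI[of _ 0]) (simp add: adapted_def)
  next
    case 2
    moreover from this have "adapted a = D (\<nu> a)" using disjoint by (auto simp: adapted_def)
    ultimately show ?thesis using leading_D by presburger
  next
    case 3
    moreover from this have "adapted a = b a" using disjoint by (auto simp: adapted_def)
    ultimately show ?thesis using leading_b by presburger
  qed
qed

lemma D_adapted:
  assumes "a \<in> X \<union> Y \<union> Z"
  shows "F2_lin D (adapted a) = (if a \<in> X then D a else 0)"
  using assms D_D D_b bij_betwE[OF \<nu>] by (auto simp: adapted_def)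

text \<open>Expanding in the adapted basis reduces the claim to \<open>X\<close>, because the
  differential already vanishes on the other basis vectors.\<close>

lemma D_D_eq_0:
  assumes "Poly_Mapping.keys c \<subseteq> X \<union> Y \<union> Z"
  shows "F2_lin D (F2_lin D c) = 0"
proof -
  obtain f where f: "Poly_Mapping.keys f \<subseteq> X \<union> Y \<union> Z" "F2_lin adapted f = c"
    using F2_lin_surj[OF assms] by blast
  have "F2_lin D (F2_lin D (adapted a)) = 0" if "a \<in> Poly_Mapping.keys f" for a
  proof -
    have "a \<in> X \<union> Y \<union> Z" using that f(1) by blast
    then show ?thesis by (cases "a \<in> X") (simp_all add: D_adapted D_D)
  qed
  then have "F2_lin (\<lambda>a. F2_lin D (F2_lin D (adapted a))) f = 0"
    unfolding F2_lin_def by (rule sum.neutral[OF ballI])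
  then show ?thesis unfolding f(2)[symmetric] F2_lin_lin by simp
qed

lemma finite_matched: "finite {a \<in> Y. \<nu> a \<in> Poly_Mapping.keys f}"
proof (rule finite_imageD)
  show "finite (\<nu> ` {a \<in> Y. \<nu> a \<in> Poly_Mapping.keys f})"
    by (rule finite_subset[OF _ finite_keys[of f]]) blast
  show "inj_on \<nu> {a \<in> Y. \<nu> a \<in> Poly_Mapping.keys f}"
    using bij_betw_imp_inj_on[OF \<nu>] by (rule inj_on_subset) blast
qed

text \<open>In adapted coordinates the differential moves the coordinate at \<open>\<nu> a\<close>
  to \<open>a\<close> and forgets the coordinates on \<open>Y\<close> and \<open>Z\<close>.\<close>

lemma D_lin_adapted:
  assumes "Poly_Mapping.keys f \<subseteq> X \<union> Y \<union> Z"
  shows "F2_lin D (F2_lin adapted f) = F2_lin adapted (F2_ind {a \<in> Y. \<nu> a \<in> Poly_Mapping.keys f})"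
proof -
  let ?M = "{a \<in> Y. \<nu> a \<in> Poly_Mapping.keys f}"
  have inj: "inj_on \<nu> ?M"
    using bij_betw_imp_inj_on[OF \<nu>] by (rule inj_on_subset) auto
  have img: "\<nu> ` ?M = Poly_Mapping.keys f \<inter> X"
    using bij_betw_imp_surj_on[OF \<nu>] by auto
  have fin: "finite ?M" by (rule finite_matched)
  have "F2_lin D (F2_lin adapted f) = (\<Sum>a \<in> Poly_Mapping.keys f. if a \<in> X then D a else 0)"
    unfolding F2_lin_lin unfolding F2_lin_def[of _ f] using assms by (intro sum.cong refl D_adapted) auto
  also have "\<dots> = sum D (Poly_Mapping.keys f \<inter> X)"
    by (simp add: sum.inter_restrict)
  also have "\<dots> = (\<Sum>a \<in> ?M. D (\<nu> a))"
    unfolding img[symmetric] using inj by (simp add: sum.reindex)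
  also have "\<dots> = sum adapted ?M"
    using disjoint by (intro sum.cong) (auto simp: adapted_def)
  finally show ?thesis using fin by (simp add: F2_lin_ind)
qed

text \<open>A cocycle has no adapted coordinate in \<open>X\<close>, as that would reappear in its
  differential at the partner in \<open>Y\<close>. Its \<open>Y\<close> part is the differential of
  the partners, and its \<open>Z\<close> part is a combination of the given cocycles.\<close>

lemma cocycle_decomposition:
  assumes c: "Poly_Mapping.keys c \<subseteq> X \<union> Y \<union> Z" and cocycle: "F2_lin D c = 0"
  obtains e u where "Poly_Mapping.keys e \<subseteq> Z" "Poly_Mapping.keys u \<subseteq> X"
    "c = F2_lin b e + F2_lin D u"
proof -
  obtain f where f: "Poly_Mapping.keys f \<subseteq> X \<union> Y \<union> Z" "F2_lin adapted f = c"
    using F2_lin_surj[OF c] by blast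
  let ?K = "Poly_Mapping.keys f" and ?M = "{a \<in> Y. \<nu> a \<in> Poly_Mapping.keys f}"
  have fin: "finite ?M" by (rule finite_matched)
  have "F2_ind ?M = 0"
  proof (rule F2_lin_inj)
    show "Poly_Mapping.keys (F2_ind ?M) \<subseteq> X \<union> Y \<union> Z" using fin by auto
    show "F2_lin adapted (F2_ind ?M) = 0" using D_lin_adapted[OF f(1)] cocycle unfolding f(2) by simp
  qed
  then have "?M = {}" using fin by (metis keys_F2_ind keys_zero)
  then have KX: "?K \<inter> X = {}" using bij_betw_imp_surj_on[OF \<nu>] by blast
  have "c = sum adapted (?K \<inter> Y) + sum adapted (?K \<inter> Z)"
    unfolding f(2)[symmetric] F2_lin_def using f(1) KX disjoint
    by (subst sum.union_disjoint[symmetric]) (auto intro!: sum.cong)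
  also have "sum adapted (?K \<inter> Z) = sum b (?K \<inter> Z)"
    using disjoint by (intro sum.cong) (auto simp: adapted_def)
  also have "sum adapted (?K \<inter> Y) = (\<Sum>a \<in> ?K \<inter> Y. D (\<nu> a))"
    using disjoint by (intro sum.cong) (auto simp: adapted_def)
  also have "\<dots> = sum D (\<nu> ` (?K \<inter> Y))"
    using inj_on_subset[OF bij_betw_imp_inj_on[OF \<nu>], of "?K \<inter> Y"] by (simp add: sum.reindex)
  finally have "c = F2_lin b (F2_ind (?K \<inter> Z)) + F2_lin D (F2_ind (\<nu> ` (?K \<inter> Y)))"
    by (simp add: F2_lin_ind add.commute)
  then show thesis
    using bij_betwE[OF \<nu>] by (intro that[of "F2_ind (?K \<inter> Z)" "F2_ind (\<nu> ` (?K \<inter> Y))"]) auto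
qed

text \<open>The adapted coordinates of the left side lie in \<open>Z\<close> and those of the right
  side in \<open>Y\<close>; as coordinates are unique, both vanish.\<close>

lemma coboundary_imp_0:
  assumes e: "Poly_Mapping.keys e \<subseteq> Z" and u: "Poly_Mapping.keys u \<subseteq> X \<union> Y \<union> Z"
    and eq: "F2_lin b e = F2_lin D u"
  shows "e = 0"
proof -
  obtain f where f: "Poly_Mapping.keys f \<subseteq> X \<union> Y \<union> Z" "F2_lin adapted f = u"
    using F2_lin_surj[OF u] by blast
  let ?M = "{a \<in> Y. \<nu> a \<in> Poly_Mapping.keys f}"
  have fin: "finite ?M" by (rule finite_matched)
  have "F2_lin adapted e = F2_lin b e"
    using e disjoint by (intro F2_lin_cong) (auto simp: adapted_def)
  then have "F2_lin adapted e = F2_lin adapted (F2_ind ?M)"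
    using D_lin_adapted[OF f(1)] eq unfolding f(2) by simp
  then have 0: "F2_lin adapted (e + F2_ind ?M) = 0"
    by (simp add: add_self_F2)
  have "e + F2_ind ?M = 0"
    by (rule F2_lin_inj[OF _ 0]) (use e fin in \<open>auto simp: keys_add_F2\<close>)
  then have "e = F2_ind ?M" by (simp add: F2_add_eq_0_iff)
  then have "Poly_Mapping.keys e \<subseteq> Y" using fin by (metis (no_types, lifting) keys_F2_ind mem_Collect_eq subsetI)
  then show ?thesis using e disjoint(3) by (metis Int_greatest keys_eq_empty subset_empty)
qed

end

section \<open>A matching of the sequences of length three\<close>

definition fn_D :: "nat list \<Rightarrow> fn_cochain" where
  "fn_D a = (\<Sum>i < length a. fn_delta a i)"

lemma fn_diff_eq_lin: "fn_diff = F2_lin fn_D"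
  by (simp add: fn_diff_def F2_lin_def fn_D_def fun_eq_iff)

lemma fn_D_3: "fn_D [x, y, z] =
  fn_delta [x, y, z] 0 + fn_delta [x, y, z] (Suc 0) + fn_delta [x, y, z] (Suc (Suc 0))"
  by (simp add: fn_D_def lessThan_Suc add_ac)

lemmas fn_D_eval = fn_D_3 fn_delta_first fn_delta_middle fn_delta_last

definition lists3 :: "nat list set" where
  "lists3 = {[x, y, z] | x y z. True}"

text \<open>The first class of the matching. The bound \<open>Suc x < y\<close> leaves out
  \<open>[x, Suc x, z]\<close> with \<open>x < z\<close>, which is the partner of
  \<open>[x, x, z]\<close>.\<close>

definition src3 :: "nat list set" where
  "src3 = {[x, y, z] | x y z. Suc x < y \<and> Suc x < z \<and> y \<le> z \<or> x < z \<and> z < y \<or> y < x \<and> x < z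
     \<or> x = y \<and> y < z \<or> z = 0 \<and> x < y}"

definition crit3 :: "nat list set" where
  "crit3 = {[x, y, z] | x y z. x = z \<and> y \<le> x \<or> y = 0 \<and> z < x}"

definition tgt3 :: "nat list set" where
  "tgt3 = lists3 - src3 - crit3"

text \<open>On \<open>tgt3\<close> every entry that is lowered by one is positive, so the truncated
  subtractions are genuine.\<close>

definition to_src :: "nat list \<Rightarrow> nat list" where
  "to_src a = (case a of [x, y, z] \<Rightarrow>
     if x < y \<and> x < z then [x, x, z]
     else if x = z then [x - 1, y, z]
     else if z = 0 then (if y = 1 then [0, x, 0] else [y - 1, x, 0])
     else if y < z then [z, y - 1, x]
     else if y = z then [y, y - 1, x]
     else [z - 1, x, y] | _ \<Rightarrow> [])"

definition to_tgt :: "nat list \<Rightarrow> nat list" where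
  "to_tgt a = (case a of [x, y, z] \<Rightarrow>
     if x = y then [x, Suc x, z]
     else if z = 0 then [y, Suc x, 0]
     else if x < y then (if Suc x < z then [y, z, Suc x] else [z, y, z])
     else [z, Suc y, x] | _ \<Rightarrow> [])"

text \<open>Elements of \<open>src3\<close> are put at the bottom, since they occur freely in the differentials.\<close>
definition rank3 :: "nat list \<Rightarrow> nat" where
  "rank3 a = (case a of [x, y, z] \<Rightarrow>
     if a \<in> src3 then 0
     else if x < y \<and> x < z then 1
     else if x = z \<and> x < y then 2
     else if 0 < z then 3 else 4 | _ \<Rightarrow> 0)"

text \<open>The given cocycles, indexed by their leading sequences. Of \<open>[x, 0, z]\<close> and
  \<open>[z, 0, x]\<close> with \<open>0 < z < x\<close> the first one leads, since the second one
  belongs to \<open>src3\<close>.\<close>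

definition crit_cocycle :: "nat list \<Rightarrow> fn_cochain" where
  "crit_cocycle a = (case a of [x, y, z] \<Rightarrow>
     if x = z then fn [x, y, x]
     else if z = 0 then fn [x, 0, 0] + fn [0, x, 0] + fn [0, 0, x]
     else fn [z, 0, x] + fn [x, 0, z] | _ \<Rightarrow> 0)"

lemma src3_iff: "[x, y, z] \<in> src3 \<longleftrightarrow> Suc x < y \<and> Suc x < z \<and> y \<le> z \<or> x < z \<and> z < y \<or> y < x \<and> x < z
     \<or> x = y \<and> y < z \<or> z = 0 \<and> x < y"
  by (simp add: src3_def)

lemma crit3_iff: "[x, y, z] \<in> crit3 \<longleftrightarrow> x = z \<and> y \<le> x \<or> y = 0 \<and> z < x"
  by (simp add: crit3_def)

lemma tgt3_iff: "[x, y, z] \<in> tgt3 \<longleftrightarrow> [x, y, z] \<notin> src3 \<and> [x, y, z] \<notin> crit3"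
  by (simp add: tgt3_def lists3_def)

text \<open>The patterns follow the clauses of \<open>to_src\<close>, with successors written out so
  that its subtractions evaluate.\<close>

lemma tgt3_cases:
  assumes "a \<in> tgt3"
  obtains (A) p r where "a = [p, Suc p, r]" "p < r"
    | (B) p r where "a = [Suc p, r, Suc p]" "Suc p < r"
    | (C1) x where "a = [x, 1, 0]" "1 \<le> x"
    | (C2) p x where "a = [x, Suc (Suc p), 0]" "Suc (Suc p) \<le> x"
    | (D) p x z where "a = [x, Suc p, z]" "Suc p < z" "z < x"
    | (E) p x where "a = [x, Suc p, Suc p]" "Suc p < x"
    | (F) p x y where "a = [x, y, Suc p]" "Suc p < x" "Suc p < y"
proof -
  obtain x y z where a: "a = [x, y, z]" using assms by (auto simp: tgt3_def lists3_def)
  have n: "\<not> (Suc x < y \<and> Suc x < z \<and> y \<le> z)" "\<not> (x < z \<and> z < y)" "\<not> (y < x \<and> x < z)"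
     "\<not> (x = y \<and> y < z)" "\<not> (z = 0 \<and> x < y)" "\<not> (x = z \<and> y \<le> x)" "\<not> (y = 0 \<and> z < x)"
    using assms unfolding a tgt3_iff src3_iff crit3_iff by blast+
  consider "x < y" "x < z" | "x = z" "x < y" | "z = 0" "y \<le> x" "y > 0" | "0 < z" "y < z" "z < x" "0 < y"
    | "0 < z" "y = z" "z < x" | "0 < z" "z < y" "z < x"
    by (cases x y rule: linorder_cases; cases x z rule: linorder_cases; cases y z rule: linorder_cases;
        use n in force)
  then show thesis
  proof cases
    case 1
    then show thesis using A[of x z] n a by (metis Suc_lessI le_less_linear not_less_eq)
  next
    case 2
    then show thesis using B[of "x - 1" y] n a by auto
  next
    case 3
    then show thesis using C1[of x] C2[of x "y - 2"] n a by (cases "y = 1") auto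
  next
    case 4
    then show thesis using D[of x "y - 1" z] a by auto
  next
    case 5
    then show thesis using E[of x "y - 1"] a by auto
  next
    case 6
    then show thesis using F[of x y "z - 1"] a by auto
  qed
qed

lemma to_src_in: "a \<in> tgt3 \<Longrightarrow> to_src a \<in> src3 \<and> to_tgt (to_src a) = a"
  by (cases a rule: tgt3_cases) (auto simp: to_src_def to_tgt_def src3_iff)

lemma to_tgt_in: "a \<in> src3 \<Longrightarrow> to_tgt a \<in> tgt3 \<and> to_src (to_tgt a) = a"
proof -
  assume a: "a \<in> src3"
  then obtain x y z where xyz: "a = [x, y, z]" by (auto simp: src3_def)
  consider "x = y" "y < z" | "z = 0" "x < y" | "z \<noteq> 0" "x < y" "Suc x < z" | "z \<noteq> 0" "x < y" "z = Suc x" "z < y"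
    | "y < x" "x < z"
    using a unfolding xyz src3_iff
    by (cases x y rule: linorder_cases; cases x z rule: linorder_cases; cases y z rule: linorder_cases; force)
  then show ?thesis unfolding xyz
    by cases (use a in \<open>auto simp: xyz to_src_def to_tgt_def src3_iff tgt3_iff crit3_iff\<close>)
qed

lemma bij_betw_to_src: "bij_betw to_src tgt3 src3"
  by (rule bij_betw_byWitness[where f' = to_tgt]) (use to_src_in to_tgt_in in auto)

section \<open>Leading terms of differentials and of the given cocycles\<close>

definition below3 :: "nat list \<Rightarrow> fn_cochain \<Rightarrow> bool" where
  "below3 a w \<longleftrightarrow> (\<forall>b \<in> Poly_Mapping.keys w. b \<in> lists3 \<and> rank3 b < rank3 a)"

lemma below3_simps:
  "below3 a 0" "below3 a (fn [x, y, z]) \<longleftrightarrow> rank3 [x, y, z] < rank3 a"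
  "below3 a w \<Longrightarrow> below3 a w' \<Longrightarrow> below3 a (w + w')"
  "(P \<Longrightarrow> below3 a w) \<Longrightarrow> (\<not> P \<Longrightarrow> below3 a w') \<Longrightarrow> below3 a (if P then w else w')"
  by (auto simp: below3_def lists3_def keys_add_F2)

text \<open>The rank is 1 for pattern A, 2 for B, 3 for D, E and F, and 4 for C1 and C2. Besides
  members of \<open>src3\<close>, the remainder contains nothing for A, B and D, pattern B for E, at
  most A for F and C1, and at most A, B and F for C2.\<close>

lemma to_src_D:
  assumes "a \<in> tgt3"
  shows "\<exists>w. fn_D (to_src a) = fn a + w \<and> below3 a w"
  using assms
proof (cases a rule: tgt3_cases)
  case (A p r)
  let ?w = "if r = Suc p then 0 else fn [p, r, Suc p]"
  have "fn_D (to_src a) = fn a + ?w" using A by (auto simp: to_src_def fn_D_eval)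
  moreover have "below3 a ?w" using A by (intro below3_simps) (auto simp: below3_simps rank3_def src3_iff)
  ultimately show ?thesis by blast
next
  case (B p r)
  let ?w = "if r = Suc (Suc p) then fn [p, r, r] else fn [p, r, Suc (Suc p)] + fn [p, Suc (Suc p), r]"
  have "fn_D (to_src a) = fn a + ?w" using B by (auto simp: to_src_def fn_D_eval add_ac)
  moreover have "below3 a ?w" using B by (intro below3_simps) (auto simp: below3_simps rank3_def src3_iff)
  ultimately show ?thesis by blast
next
  case (C1 x)
  let ?w = "if x = 1 then fn [0, 1, 1] else fn [1, x, 0] + (fn [0, 1, x] + fn [0, x, 1])"
  have "fn_D (to_src a) = fn a + ?w" using C1 by (auto simp: to_src_def fn_D_eval add_ac)
  moreover have "below3 a ?w" using C1 by (intro below3_simps) (auto simp: below3_simps rank3_def src3_iff)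
  ultimately show ?thesis by blast
next
  case (C2 p x)
  let ?w = "(if x = Suc (Suc p) then 0 else fn [Suc (Suc p), x, 0]) +
    (if p = 0 then fn [1, x, 1] else fn [Suc p, x, 1] + fn [1, Suc p, x])"
  have "fn_D (to_src a) = fn a + ?w" using C2 by (auto simp: to_src_def fn_D_eval add_ac)
  moreover have "below3 a ?w" using C2 by (intro below3_simps) (auto simp: below3_simps rank3_def src3_iff)
  ultimately show ?thesis by blast
next
  case (D p x z)
  have "fn_D (to_src a) = fn a + fn [z, Suc p, x]" using D by (auto simp: to_src_def fn_D_eval add_ac)
  moreover have "below3 a (fn [z, Suc p, x])" using D by (auto simp: below3_simps rank3_def src3_iff)
  ultimately show ?thesis by blast
next
  case (E p x)
  let ?w = "fn [Suc p, x, Suc p] + fn [Suc p, Suc p, x]"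
  have "fn_D (to_src a) = fn a + ?w" using E by (auto simp: to_src_def fn_D_eval fn_arr_def add_ac)
  moreover have "below3 a ?w" using E by (intro below3_simps) (auto simp: below3_simps rank3_def src3_iff)
  ultimately show ?thesis by blast
next
  case (F p x y)
  let ?w = "fn [Suc p, x, y] +
    (if x < y then if y = Suc x then fn [p, y, y] else fn [p, Suc x, y] + fn [p, y, Suc x]
     else if y < x then if x = Suc y then fn [p, x, x] else fn [p, x, Suc y] + fn [p, Suc y, x]
     else 0)"
  have "fn_D (to_src a) = fn a + ?w" using F by (auto simp: to_src_def fn_D_eval add_ac)
  moreover have "below3 a ?w" using F by (intro below3_simps) (auto simp: below3_simps rank3_def src3_iff)
  ultimately show ?thesis by blast
qed

text \<open>The other terms of a given cocycle lie in \<open>src3\<close> and have rank 0, whereas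
  those leading terms have rank 3 or 4.\<close>

lemma crit_cocycle_leading: "a \<in> crit3 \<Longrightarrow> \<exists>w. crit_cocycle a = fn a + w \<and> below3 a w"
proof -
  assume "a \<in> crit3"
  then consider x y where "a = [x, y, x]" "y \<le> x" | x where "a = [x, 0, 0]" "0 < x"
    | x z where "a = [x, 0, z]" "0 < z" "z < x"
    by (force simp: crit3_def)
  then show ?thesis
  proof cases
    case 1
    then show ?thesis by (intro exI[of _ 0]) (simp add: crit_cocycle_def below3_simps)
  next
    case (2 x)
    then show ?thesis by (intro exI[of _ "fn [0, x, 0] + fn [0, 0, x]"] conjI below3_simps)
      (auto simp: crit_cocycle_def below3_simps rank3_def src3_iff add_ac)
  next
    case (3 x z)
    then show ?thesis by (intro exI[of _ "fn [z, 0, x]"] conjI)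
      (auto simp: crit_cocycle_def below3_simps rank3_def src3_iff add_ac)
  qed
qed

text \<open>With a middle entry not above the outer ones only the middle differential can
  contribute, and it is unchanged when the outer entries are exchanged. So it vanishes on
  \<open>[x, y, x]\<close>, and the two terms \<open>[z, 0, x]\<close> and \<open>[x, 0, z]\<close>
  cancel. In the three-term sum, the outer differentials of \<open>[0, x, 0]\<close> cancel the
  middle ones of the other two.\<close>

lemma fn_D_crit_cocycle: "a \<in> crit3 \<Longrightarrow> F2_lin fn_D (crit_cocycle a) = 0"
proof -
  assume "a \<in> crit3"
  then consider x y where "a = [x, y, x]" "y \<le> x" | x where "a = [x, 0, 0]" "0 < x"
    | x z where "a = [x, 0, z]" "0 < z" "z < x"
    by (force simp: crit3_def)
  then show ?thesis
    by cases (auto simp: crit_cocycle_def fn_D_eval fn_arr_def add_ac add_self_F2 add_left_self_F2)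
qed

lemma src3_cases:
  assumes "a \<in> src3"
  obtains (A) p y z where "a = [p, y, z]" "Suc p < y" "y \<le> z"
    | (B) p y z where "a = [p, y, z]" "p < z" "z < y"
    | (C) x p z where "a = [x, p, z]" "p < x" "x < z"
    | (D) p z where "a = [p, p, z]" "p < z"
    | (E) p where "a = [0, p, 0]" "0 < p"
    | (F) p y where "a = [Suc p, y, 0]" "Suc p < y"
proof -
  obtain x y z where a: "a = [x, y, z]" using assms by (auto simp: src3_def)
  consider "Suc x < y" "y \<le> z" | "x < z" "z < y" | "y < x" "x < z" | "x = y" "y < z"
    | "z = 0" "x = 0" "0 < y" | "z = 0" "x = Suc (x - 1)" "x < y"
    using assms unfolding a src3_iff by force
  then show thesis using that a by cases metis+
qed


lemmas F2_ac = add_ac add_self_F2 add_left_self_F2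

lemma crit_cocycle_inj: "inj_on crit_cocycle crit3"
proof (rule inj_onI)
  fix a b assume a: "a \<in> crit3" and b: "b \<in> crit3" and eq: "crit_cocycle a = crit_cocycle b"
  obtain w where w: "crit_cocycle a = fn a + w" "below3 a w" using crit_cocycle_leading[OF a] by blast
  obtain w' where w': "crit_cocycle b = fn b + w'" "below3 b w'" using crit_cocycle_leading[OF b] by blast
  show "a = b"
  proof (rule ccontr)
    assume ne: "a \<noteq> b"
    \<comment> \<open>Each leading term would have to occur in the lower part of the other cocycle,
      so each rank would be smaller than the other.\<close>
    have "a \<in> Poly_Mapping.keys (fn a + w)" "b \<in> Poly_Mapping.keys (fn b + w')"
      using w w' by (auto simp: keys_add_F2 below3_def)
    then have "a \<in> Poly_Mapping.keys (fn b + w')" "b \<in> Poly_Mapping.keys (fn a + w)"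
      using eq w w' by simp_all
    then have "rank3 a < rank3 b" "rank3 b < rank3 a"
      using w(2) w'(2) ne by (auto simp: keys_add_F2 below3_def)
    then show False by simp
  qed
qed

lemma crit_cocycle_image:
  "crit_cocycle ` crit3 = {fn [a,0,0] + fn [0,a,0] + fn [0,0,a] | a. 0 < a}
           \<union> {fn [a,0,b] + fn [b,0,a] | a b. 0 < a \<and> a < b}
           \<union> {fn [b,a,b] | a b. a \<le> b}" (is "_ = ?A \<union> ?B \<union> ?C")
proof (intro equalityI subsetI)
  fix c assume "c \<in> crit_cocycle ` crit3"
  then obtain x y z where "c = crit_cocycle [x, y, z]" "[x, y, z] \<in> crit3" by (auto simp: crit3_def)
  then consider "c = fn [x, y, x]" "y \<le> x" | "c = fn [x, 0, 0] + fn [0, x, 0] + fn [0, 0, x]" "0 < x"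
    | "c = fn [z, 0, x] + fn [x, 0, z]" "0 < z" "z < x"
    by (auto simp: crit_cocycle_def crit3_iff split: if_splits)
  then show "c \<in> ?A \<union> ?B \<union> ?C" by cases blast+
next
  fix c assume "c \<in> ?A \<union> ?B \<union> ?C"
  then consider x y where "c = fn [x, y, x]" "y \<le> x" | x where "c = fn [x, 0, 0] + fn [0, x, 0] + fn [0, 0, x]" "0 < x"
    | x z where "c = fn [z, 0, x] + fn [x, 0, z]" "0 < z" "z < x"
    by blast
  then show "c \<in> crit_cocycle ` crit3"
  proof cases
    case (1 x y)
    then show ?thesis by (intro image_eqI[of _ _ "[x, y, x]"]) (simp_all add: crit_cocycle_def crit3_iff)
  next
    case (2 x)
    then show ?thesis by (intro image_eqI[of _ _ "[x, 0, 0]"]) (simp_all add: crit_cocycle_def crit3_iff)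
  next
    case (3 x z)
    then show ?thesis by (intro image_eqI[of _ _ "[x, 0, z]"]) (simp_all add: crit_cocycle_def crit3_iff)
  qed
qed

lemma keys_crit_cocycle: "a \<in> crit3 \<Longrightarrow> Poly_Mapping.keys (crit_cocycle a) \<subseteq> lists3"
  using crit_cocycle_leading[of a] by (auto simp: below3_def keys_add_F2 crit3_def lists3_def)

definition sum_Suc :: "nat list \<Rightarrow> fn_cochain \<Rightarrow> bool" where
  "sum_Suc a c \<longleftrightarrow> (\<forall>b \<in> Poly_Mapping.keys c. b \<in> lists3 \<and> sum_list b = Suc (sum_list a))"

lemma sum_Suc_simps:
  "sum_Suc a 0" "sum_Suc a (fn [x, y, z]) \<longleftrightarrow> x + (y + z) = Suc (sum_list a)"
  "sum_Suc a w \<Longrightarrow> sum_Suc a w' \<Longrightarrow> sum_Suc a (w + w')"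
  by (auto simp: sum_Suc_def lists3_def keys_add_F2)

lemma sum_Suc_fn_D:
  assumes "a \<in> lists3"
  shows "sum_Suc a (fn_D a)"
proof -
  obtain x y z where a: "a = [x, y, z]" using assms by (auto simp: lists3_def)
  have "sum_Suc a (fn_delta a 0)" unfolding a fn_delta_first
    by (auto intro!: sum_Suc_simps(3) simp: sum_Suc_simps(1,2))
  moreover have "sum_Suc a (fn_delta a (Suc 0))" unfolding a fn_delta_middle fn_arr_def
    by (auto intro!: sum_Suc_simps(3) simp: sum_Suc_simps(1,2))
  moreover have "sum_Suc a (fn_delta a (Suc (Suc 0)))" unfolding a fn_delta_last
    by (auto intro!: sum_Suc_simps(3) simp: sum_Suc_simps(1,2))
  ultimately show ?thesis unfolding a fn_D_3 by (intro sum_Suc_simps(3))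
qed

lemma src3_crit3: "src3 \<inter> crit3 = {}"
  by (auto simp: src3_def crit3_def)

lemma src3_tgt3_crit3: "src3 \<union> tgt3 \<union> crit3 = lists3"
  by (auto simp: src3_def crit3_def tgt3_def lists3_def)

text \<open>Direct computation on the first class suffices, because the matching extends the
  identity to all sequences.\<close>

lemma fn_D_fn_D: "a \<in> src3 \<Longrightarrow> F2_lin fn_D (fn_D a) = 0"
  by (cases a rule: src3_cases) (auto simp: fn_D_eval fn_arr_def F2_ac)

text \<open>The map \<open>to_src\<close> serves as \<open>\<nu>\<close>. The three classes exhaust
  \<open>lists3\<close>, so the conclusions apply to every cochain in \<open>FN 4\<close>.\<close>

interpretation FN4: F2_matching src3 tgt3 crit3 fn_D crit_cocycle to_src rank3
proof
  show "\<exists>w. fn_D (to_src a) = fn a + w \<and>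
      (\<forall>b \<in> Poly_Mapping.keys w. b \<in> src3 \<union> tgt3 \<union> crit3 \<and> rank3 b < rank3 a)" if "a \<in> tgt3" for a
    using to_src_D[OF that] unfolding src3_tgt3_crit3 below3_def .
  show "\<exists>w. crit_cocycle a = fn a + w \<and>
      (\<forall>b \<in> Poly_Mapping.keys w. b \<in> src3 \<union> tgt3 \<union> crit3 \<and> rank3 b < rank3 a)" if "a \<in> crit3" for a
    using crit_cocycle_leading[OF that] unfolding src3_tgt3_crit3 below3_def .
qed (use src3_crit3 bij_betw_to_src fn_D_fn_D fn_D_crit_cocycle in \<open>auto simp: tgt3_def\<close>)

section \<open>Groups of exponent two and direct sums\<close>

lemma comm_group_F2:
  fixes A :: "'c::ab_group_add set"
  assumes "0 \<in> A" "\<And>x y. x \<in> A \<Longrightarrow> y \<in> A \<Longrightarrow> x + y \<in> A" "\<And>x. x \<in> A \<Longrightarrow> x + x = 0"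
  shows "comm_group \<lparr>carrier = A, monoid.mult = (+), monoid.one = 0\<rparr>"
proof (rule comm_groupI)
  fix x assume "x \<in> carrier \<lparr>carrier = A, monoid.mult = (+), monoid.one = 0\<rparr>"
  then show "\<exists>y \<in> carrier \<lparr>carrier = A, monoid.mult = (+), monoid.one = 0\<rparr>.
      y \<otimes>\<^bsub>\<lparr>carrier = A, monoid.mult = (+), monoid.one = 0\<rparr>\<^esub> x =
      \<one>\<^bsub>\<lparr>carrier = A, monoid.mult = (+), monoid.one = 0\<rparr>\<^esub>"
    using assms(3) by auto
qed (use assms in \<open>auto simp: add_ac\<close>)

lemma subgroup_F2:
  fixes A :: "'c::ab_group_add set"
  assumes A: "0 \<in> A" "\<And>x y. x \<in> A \<Longrightarrow> y \<in> A \<Longrightarrow> x + y \<in> A" "\<And>x. x \<in> A \<Longrightarrow> x + x = 0"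
    and N: "N \<subseteq> A" "0 \<in> N" "\<And>x y. x \<in> N \<Longrightarrow> y \<in> N \<Longrightarrow> x + y \<in> N"
  shows "subgroup N \<lparr>carrier = A, monoid.mult = (+), monoid.one = 0\<rparr>"
proof -
  interpret comm_group "\<lparr>carrier = A, monoid.mult = (+), monoid.one = 0\<rparr>"
    using A by (rule comm_group_F2)
  have "inv\<^bsub>\<lparr>carrier = A, monoid.mult = (+), monoid.one = 0\<rparr>\<^esub> x = x" if "x \<in> A" for x
    using that A(3) by (intro inv_equality) auto
  then show ?thesis using N by unfold_locales auto
qed

lemma (in comm_group) comm_group_Mod:
  assumes "subgroup N G"
  shows "comm_group (G Mod N)"
proof -
  interpret normal N G using assms by (simp add: normal_iff_subgroup)
  show ?thesis
    by (rule group.group_comm_groupI[OF factorgroup_is_group])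
      (auto simp: FactGroup_def RCOSETS_def rcos_sum m_comm)
qed

text \<open>The set \<open>J\<close> of cochains is its own index set, as in the basis to be
  established; a product of classes becomes the class of a sum.\<close>

lemma (in comm_group) finprod_additive:
  fixes A :: "'c::ab_group_add set"
  assumes A: "0 \<in> A" "\<And>x y. x \<in> A \<Longrightarrow> y \<in> A \<Longrightarrow> x + y \<in> A"
    and h: "\<And>x. x \<in> A \<Longrightarrow> h x \<in> carrier G" "h 0 = \<one>"
      "\<And>x y. x \<in> A \<Longrightarrow> y \<in> A \<Longrightarrow> h (x + y) = h x \<otimes> h y"
    and J: "finite J" "J \<subseteq> A"
  shows "finprod G h J = h (\<Sum>J) \<and> \<Sum>J \<in> A"
  using J
proof (induction J rule: finite_induct)
  case empty
  then show ?case using A h by simp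
next
  case (insert x J)
  have "finprod G h (insert x J) = h x \<otimes> finprod G h J"
    using insert h by (intro finprod_insert) auto
  then show ?case using insert A h by auto
qed

lemma F2_basis_iso:
  assumes G: "comm_group G" and H: "comm_group H" and h: "h \<in> iso G H" and f: "F2_basis G I f"
  shows "F2_basis H I (\<lambda>i. h (f i))"
proof -
  interpret G: comm_group G by fact
  interpret H: comm_group H by fact
  have hom: "h \<in> hom G H" and bij: "bij_betw h (carrier G) (carrier H)"
    using h by (auto simp: iso_def)
  have fI: "f i \<in> carrier G" if "i \<in> I" for i using f that by (auto simp: F2_basis_def)
  have fin: "finprod H (\<lambda>i. h (f i)) J = h (finprod G f J)" if "finite J" "J \<subseteq> I" for J
    using that
  proof (induction J rule: finite_induct)
    case empty
    then show ?case using hom_one[OF hom] G.is_group H.is_group by simp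
  next
    case (insert i J)
    then have i: "f i \<in> carrier G" and fJ: "f \<in> J \<rightarrow> carrier G" using fI by auto
    have "finprod H (\<lambda>i. h (f i)) (insert i J) = h (f i) \<otimes>\<^bsub>H\<^esub> finprod H (\<lambda>i. h (f i)) J"
      using insert.hyps i fJ hom_in_carrier[OF hom] by (intro H.finprod_insert) auto
    also have "\<dots> = h (f i \<otimes>\<^bsub>G\<^esub> finprod G f J)"
      using insert i G.finprod_closed[OF fJ] by (simp add: hom_mult[OF hom])
    also have "f i \<otimes>\<^bsub>G\<^esub> finprod G f J = finprod G f (insert i J)"
      using insert.hyps i fJ by (intro G.finprod_insert[symmetric]) auto
    finally show ?case .
  qed
  have closed: "finprod G f J \<in> carrier G" if "J \<subseteq> I" for J
    using that fI by (intro G.finprod_closed) auto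
  have "\<exists>!J. finite J \<and> J \<subseteq> I \<and> y = finprod H (\<lambda>i. h (f i)) J" if y: "y \<in> carrier H" for y
  proof -
    obtain x where x: "x \<in> carrier G" "y = h x" using bij y by (auto simp: bij_betw_def)
    have "y = finprod H (\<lambda>i. h (f i)) J \<longleftrightarrow> x = finprod G f J" if "finite J" "J \<subseteq> I" for J
      unfolding fin[OF that] x(2) using bij x(1) closed[OF that(2)]
      by (metis bij_betw_def inj_on_eq_iff)
    then have "finite J \<and> J \<subseteq> I \<and> y = finprod H (\<lambda>i. h (f i)) J \<longleftrightarrow>
      finite J \<and> J \<subseteq> I \<and> x = finprod G f J" for J by blast
    then show ?thesis using f x(1) unfolding F2_basis_def by simp
  qed
  then show ?thesis using fI hom_in_carrier[OF hom] unfolding F2_basis_def by auto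
qed

text \<open>
  This makes the singular cohomology a group without \<open>d \<circ> d = 0\<close>: the isomorphism provides
  the group laws, and the subgroup of coboundaries is idempotent, hence the identity.
\<close>
lemma comm_group_iso_idempotent:
  assumes G: "comm_group G" and h: "h \<in> iso G H"
    and one: "\<one>\<^bsub>H\<^esub> \<in> carrier H" "\<one>\<^bsub>H\<^esub> \<otimes>\<^bsub>H\<^esub> \<one>\<^bsub>H\<^esub> = \<one>\<^bsub>H\<^esub>"
  shows "comm_group H"
proof -
  interpret G: comm_group G by fact
  interpret H': comm_group "H\<lparr>one := h \<one>\<^bsub>G\<^esub>\<rparr>" using h by (rule G.iso_imp_img_comm_group)
  have "\<one>\<^bsub>H\<^esub> = h \<one>\<^bsub>G\<^esub>"
    using H'.l_cancel_one[of "\<one>\<^bsub>H\<^esub>" "\<one>\<^bsub>H\<^esub>"] one by simp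
  then have "H\<lparr>one := h \<one>\<^bsub>G\<^esub>\<rparr> = H" by simp
  then show ?thesis using H'.comm_group_axioms by simp
qed

section \<open>Direct sums over all degrees\<close>

lemma carrier_sum_group_UNIV:
  assumes "\<And>i. group (G i)"
  shows "carrier (sum_group UNIV G) = {x. (\<forall>i. x i \<in> carrier (G i)) \<and> finite {i. x i \<noteq> \<one>\<^bsub>G i\<^esub>}}"
  using assms by (auto simp: carrier_sum_group)

lemma comm_group_sum_group:
  assumes "\<And>i. comm_group (G i)"
  shows "comm_group (sum_group UNIV G)"
proof -
  have G: "group (G i)" for i using assms by (simp add: comm_group_def)
  show ?thesis
    by (rule group.group_comm_groupI)
      (auto simp: G carrier_sum_group_UNIV restrict_def fun_eq_iff
        intro: comm_monoid.m_comm[OF comm_group.axioms(1)[OF assms]])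
qed

text \<open>Each component is injective and preserves the neutral element, so the map and its
  componentwise inverse preserve finite support.\<close>

lemma iso_sum_group:
  assumes G: "\<And>i. group (G i)" and H: "\<And>i. group (H i)" and h: "\<And>i. h i \<in> iso (G i) (H i)"
  shows "(\<lambda>x i. h i (x i)) \<in> iso (sum_group UNIV G) (sum_group UNIV H)"
proof -
  have hom: "h i \<in> hom (G i) (H i)" and bij: "bij_betw (h i) (carrier (G i)) (carrier (H i))" for i
    using h by (auto simp: iso_def)
  have one: "h i x = \<one>\<^bsub>H i\<^esub> \<longleftrightarrow> x = \<one>\<^bsub>G i\<^esub>" if "x \<in> carrier (G i)" for i x
    using that hom_one[OF hom G H] bij group.is_monoid[OF G] monoid.one_closed
    by (metis bij_betw_def inj_on_eq_iff)
  show ?thesis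
  proof (rule isoI)
    show "(\<lambda>x i. h i (x i)) \<in> hom (sum_group UNIV G) (sum_group UNIV H)"
      by (rule homI) (auto simp: carrier_sum_group_UNIV G H one hom_in_carrier[OF hom] hom_mult[OF hom] cong: conj_cong)
    show "bij_betw (\<lambda>x i. h i (x i)) (carrier (sum_group UNIV G)) (carrier (sum_group UNIV H))"
    proof (rule bij_betw_byWitness)
      let ?g = "\<lambda>i. inv_into (carrier (G i)) (h i)"
      have g: "?g i y \<in> carrier (G i)" "h i (?g i y) = y" if "y \<in> carrier (H i)" for i y
        using that bij[of i] by (auto simp: bij_betw_def inv_into_into f_inv_into_f)
      have g_h: "?g i (h i x) = x" if "x \<in> carrier (G i)" for i x
        using that bij[of i] by (auto simp: bij_betw_def)
      show "\<forall>x \<in> carrier (sum_group UNIV G). (\<lambda>i. ?g i (h i (x i))) = x"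
        using g_h by (auto simp: carrier_sum_group_UNIV G)
      show "\<forall>y \<in> carrier (sum_group UNIV H). (\<lambda>i. h i (?g i (y i))) = y"
        using g by (auto simp: carrier_sum_group_UNIV H)
      show "(\<lambda>x i. h i (x i)) ` carrier (sum_group UNIV G) \<subseteq> carrier (sum_group UNIV H)"
        by (auto simp: carrier_sum_group_UNIV G H one hom_in_carrier[OF hom])
      have "?g i y = \<one>\<^bsub>G i\<^esub> \<longleftrightarrow> y = \<one>\<^bsub>H i\<^esub>" if "y \<in> carrier (H i)" for i y
        using one[OF g(1)[OF that]] g(2)[OF that] by simp
      then show "(\<lambda>y i. ?g i (y i)) ` carrier (sum_group UNIV H) \<subseteq> carrier (sum_group UNIV G)"
        using g by (auto simp: carrier_sum_group_UNIV G H)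
    qed
  qed
qed

text \<open>The neutral element is the set of coboundaries. It is the coset of the cocycle 0, and it
  equals its own sumset because it contains 0 and is closed under addition.\<close>

lemma cohom_one_idempotent:
  fixes C :: "nat \<Rightarrow> 'c::ab_group_add set"
  assumes C: "\<And>j. 0 \<in> C j" "\<And>j x y. x \<in> C j \<Longrightarrow> y \<in> C j \<Longrightarrow> x + y \<in> C j"
    and d: "\<And>j x y. x \<in> C j \<Longrightarrow> y \<in> C j \<Longrightarrow> d j (x + y) = d j x + d j y"
  shows "\<one>\<^bsub>cohom C d k\<^esub> \<in> carrier (cohom C d k)"
    "\<one>\<^bsub>cohom C d k\<^esub> \<otimes>\<^bsub>cohom C d k\<^esub> \<one>\<^bsub>cohom C d k\<^esub> = \<one>\<^bsub>cohom C d k\<^esub>"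
proof -
  have d0: "d j 0 = 0" for j using d[of 0 j 0] C(1) by simp
  let ?N = "coboundaries C d k"
  have N0: "0 \<in> ?N"
    using C(1) d0 by (auto simp: coboundaries_def split: nat.split intro!: image_eqI[of _ _ 0])
  have Nadd: "x + y \<in> ?N" if xy: "x \<in> ?N" "y \<in> ?N" for x y
  proof (cases k)
    case 0
    then show ?thesis using xy by (simp add: coboundaries_def)
  next
    case (Suc j)
    then obtain u v where "u \<in> C j" "v \<in> C j" "x = d j u" "y = d j v"
      using xy by (auto simp: coboundaries_def)
    then show ?thesis using Suc C(2) d by (auto simp: coboundaries_def intro!: image_eqI[of _ _ "u + v"])
  qed
  have "?N = ?N #>\<^bsub>cocycle_group C d k\<^esub> 0" by (auto simp: r_coset_def cocycle_group_def)
  then show "\<one>\<^bsub>cohom C d k\<^esub> \<in> carrier (cohom C d k)"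
    using C(1) d0 by (auto simp: cohom_def FactGroup_def RCOSETS_def cocycle_group_def)
  have "x \<in> ?N <#>\<^bsub>cocycle_group C d k\<^esub> ?N \<longleftrightarrow> x \<in> ?N" for x
    using N0 Nadd by (force simp: set_mult_def cocycle_group_def intro: exI[of _ 0])
  then show "\<one>\<^bsub>cohom C d k\<^esub> \<otimes>\<^bsub>cohom C d k\<^esub> \<one>\<^bsub>cohom C d k\<^esub> = \<one>\<^bsub>cohom C d k\<^esub>"
    by (auto simp: cohom_def FactGroup_def)
qed

lemma H_sing_one:
  "\<one>\<^bsub>H_sing X k\<^esub> \<in> carrier (H_sing X k)"
  "\<one>\<^bsub>H_sing X k\<^esub> \<otimes>\<^bsub>H_sing X k\<^esub> \<one>\<^bsub>H_sing X k\<^esub> = \<one>\<^bsub>H_sing X k\<^esub>"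
proof -
  have "coboundary X j (\<phi> + \<psi>) = coboundary X j \<phi> + coboundary X j \<psi>" for j \<phi> \<psi>
    by (rule ext) (simp only: coboundary_def plus_fun_apply sum.distrib if_distrib add_0_right split: if_split, blast)
  then show "\<one>\<^bsub>H_sing X k\<^esub> \<in> carrier (H_sing X k)"
    "\<one>\<^bsub>H_sing X k\<^esub> \<otimes>\<^bsub>H_sing X k\<^esub> \<one>\<^bsub>H_sing X k\<^esub> = \<one>\<^bsub>H_sing X k\<^esub>"
    unfolding H_sing_def by (intro cohom_one_idempotent; simp add: cochains_def)+
qed

section \<open>The cohomology in terms of cocycles\<close>

lemma FN_4: "FN 4 = {c. Poly_Mapping.keys c \<subseteq> lists3}"
proof -
  have "length a = 3 \<longleftrightarrow> a \<in> lists3" for a :: "nat list"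
    by (auto simp: lists3_def numeral_3_eq_3 length_Suc_conv)
  then show ?thesis by (auto simp: FN_def)
qed

lemma FN_deg_4: "FN_deg 4 k = {c \<in> FN 4. \<forall>a \<in> Poly_Mapping.keys c. sum_list a = k}"
  by (simp add: FN_deg_def)

lemma fn_part_eq: "fn_part k c = F2_ind {a \<in> Poly_Mapping.keys c. sum_list a = k}"
  by (simp add: fn_part_def F2_ind_def)

lemma keys_fn_part [simp]: "Poly_Mapping.keys (fn_part k c) = {a \<in> Poly_Mapping.keys c. sum_list a = k}"
  by (simp add: fn_part_eq)

lemma fn_part_add: "fn_part k (c + c') = fn_part k c + fn_part k c'"
  by (rule F2_eqI) (auto simp: keys_add_F2)

lemma fn_part_0 [simp]: "fn_part k 0 = 0"
  by (rule F2_eqI) simp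

lemma sum_fn_part:
  assumes "finite K" "sum_list ` Poly_Mapping.keys c \<subseteq> K"
  shows "(\<Sum>k \<in> K. fn_part k c) = c"
proof -
  have "(\<Sum>k \<in> K. fn_part k c) = (\<Sum>a \<in> Poly_Mapping.keys c. fn a)"
    unfolding fn_part_def using assms by (intro sum.group) auto
  then show ?thesis by (metis F2_ind_def F2_ind_keys)
qed

lemma fn_diff_add: "fn_diff (c + c') = fn_diff c + fn_diff c'"
  by (simp add: fn_diff_eq_lin)

lemma keys_fn_diff:
  assumes "c \<in> FN 4" "b \<in> Poly_Mapping.keys (fn_diff c)"
  shows "b \<in> lists3 \<and> (\<exists>a \<in> Poly_Mapping.keys c. sum_list b = Suc (sum_list a))"
proof -
  obtain a where a: "a \<in> Poly_Mapping.keys c" "b \<in> Poly_Mapping.keys (fn_D a)"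
    using keys_F2_lin[of fn_D c] assms(2) unfolding fn_diff_eq_lin by blast
  then have "sum_Suc a (fn_D a)" using assms(1) by (intro sum_Suc_fn_D) (auto simp: FN_4)
  then show ?thesis using a by (auto simp: sum_Suc_def)
qed

lemma fn_diff_in_FN: "c \<in> FN 4 \<Longrightarrow> fn_diff c \<in> FN 4"
  using keys_fn_diff by (auto simp: FN_4)

lemma fn_part_in_FN_deg: "c \<in> FN 4 \<Longrightarrow> fn_part k c \<in> FN_deg 4 k"
  by (auto simp: FN_4 FN_deg_4)

lemma FN_add: "c \<in> FN 4 \<Longrightarrow> c' \<in> FN 4 \<Longrightarrow> c + c' \<in> FN 4"
  by (auto simp: FN_4 keys_add_F2)

lemma FN_sum: "(\<And>i. i \<in> I \<Longrightarrow> f i \<in> FN 4) \<Longrightarrow> sum f I \<in> FN 4"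
  by (induction I rule: infinite_finite_induct) (auto simp: FN_add, simp_all add: FN_4)

lemma fn_diff_fn_diff: "c \<in> FN 4 \<Longrightarrow> fn_diff (fn_diff c) = 0"
  using FN4.D_D_eq_0[of c] unfolding src3_tgt3_crit3 fn_diff_eq_lin by (simp add: FN_4)

text \<open>The differential raises degrees by exactly one, so it commutes with taking homogeneous
  parts up to this shift and has no part in degree 0.\<close>

lemma fn_part_fn_diff:
  assumes c: "c \<in> FN 4"
  shows "fn_part (Suc k) (fn_diff c) = fn_diff (fn_part k c)" "fn_part 0 (fn_diff c) = 0"
proof -
  \<comment> \<open>Inserting \<open>k\<close> makes the summand for \<open>k\<close> present even
    if no term of \<open>c\<close> has degree \<open>k\<close>.\<close>
  let ?K = "insert k (sum_list ` Poly_Mapping.keys c)"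
  have part: "fn_part (Suc k) (fn_diff (fn_part l c)) = (if l = k then fn_diff (fn_part l c) else 0)" for l
  proof (rule F2_eqI)
    have "fn_part l c \<in> FN 4" using c by (auto simp: FN_4)
    then have "sum_list b = Suc l" if "b \<in> Poly_Mapping.keys (fn_diff (fn_part l c))" for b
      using keys_fn_diff that by fastforce
    then show "Poly_Mapping.keys (fn_part (Suc k) (fn_diff (fn_part l c))) =
      Poly_Mapping.keys (if l = k then fn_diff (fn_part l c) else 0)" by auto
  qed
  have fn_part_sum: "fn_part (Suc k) (sum f I) = (\<Sum>i\<in>I. fn_part (Suc k) (f i))" for f and I :: "nat set"
    by (induction I rule: infinite_finite_induct) (simp_all add: fn_part_add)
  have "(\<Sum>l \<in> ?K. fn_part l c) = c" by (rule sum_fn_part) auto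
  then have "fn_diff c = (\<Sum>l \<in> ?K. fn_diff (fn_part l c))"
    using F2_lin_sum[of fn_D "\<lambda>l. fn_part l c" ?K] unfolding fn_diff_eq_lin by argo
  then have "fn_part (Suc k) (fn_diff c) = (\<Sum>l \<in> ?K. if l = k then fn_diff (fn_part l c) else 0)"
    by (simp only: fn_part_sum part)
  then show "fn_part (Suc k) (fn_diff c) = fn_diff (fn_part k c)"
    by (simp only: sum.delta finite_insert finite_imageI finite_keys insertI1 if_True)
  have "sum_list b \<noteq> 0" if "b \<in> Poly_Mapping.keys (fn_diff c)" for b
    using keys_fn_diff[OF c that] by (metis nat.distinct(1))
  then show "fn_part 0 (fn_diff c) = 0"
    by (intro F2_eqI) (simp del: sum_list_eq_0_iff)
qed

section \<open>Cohomology in a single degree\<close>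

abbreviation cocycles4 :: "nat \<Rightarrow> fn_cochain monoid" where
  "cocycles4 \<equiv> cocycle_group (FN_deg 4) (\<lambda>_. fn_diff)"

abbreviation coboundaries4 :: "nat \<Rightarrow> fn_cochain set" where
  "coboundaries4 \<equiv> coboundaries (FN_deg 4) (\<lambda>_. fn_diff)"

lemma fn_diff_0 [simp]: "fn_diff 0 = 0"
  by (simp add: fn_diff_def)

lemma zero_in_coboundaries4: "0 \<in> coboundaries4 k"
  by (cases k) (auto simp: coboundaries_def FN_deg_def FN_def intro!: image_eqI[of _ _ 0])

lemma FN_deg_add: "c \<in> FN_deg 4 k \<Longrightarrow> c' \<in> FN_deg 4 k \<Longrightarrow> c + c' \<in> FN_deg 4 k"
  by (auto simp: FN_4 FN_deg_4 keys_add_F2)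

lemma comm_group_cocycles4: "comm_group (cocycles4 k)"
  unfolding cocycle_group_def
  by (rule comm_group_F2) (auto simp: FN_deg_add fn_diff_add add_self_F2, simp add: FN_deg_4 FN_4)

lemma subgroup_coboundaries4: "subgroup (coboundaries4 k) (cocycles4 k)"
  unfolding cocycle_group_def
proof (rule subgroup_F2)
  show "coboundaries4 k \<subseteq> {c \<in> FN_deg 4 k. fn_diff c = 0}"
  proof (cases k)
    case 0
    then show ?thesis by (auto simp: coboundaries_def FN_deg_4 FN_4)
  next
    case (Suc j)
    have "fn_diff u \<in> FN_deg 4 (Suc j)" if "u \<in> FN_deg 4 j" for u
      using that fn_diff_in_FN[of u] keys_fn_diff[of u] by (fastforce simp: FN_deg_4)
    then show ?thesis using Suc fn_diff_fn_diff by (auto simp: coboundaries_def FN_deg_4)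
  qed
  show "x + y \<in> coboundaries4 k" if xy: "x \<in> coboundaries4 k" "y \<in> coboundaries4 k" for x y
  proof (cases k)
    case 0
    then show ?thesis using xy by (simp add: coboundaries_def)
  next
    case (Suc j)
    then obtain u v where "u \<in> FN_deg 4 j" "v \<in> FN_deg 4 j" "x = fn_diff u" "y = fn_diff v"
      using xy by (auto simp: coboundaries_def)
    then show ?thesis using Suc FN_deg_add
      by (auto simp: coboundaries_def fn_diff_add intro!: image_eqI[of _ _ "u + v"])
  qed
qed (auto simp: FN_deg_add fn_diff_add add_self_F2 zero_in_coboundaries4, simp add: FN_deg_4 FN_4)

lemma comm_group_H_FN_4: "comm_group (H_FN 4 k)"
  unfolding H_FN_def cohom_def
  using comm_group_cocycles4 subgroup_coboundaries4 by (rule comm_group.comm_group_Mod)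

lemma cohom_class_hom:
  "cohom_class (FN_deg 4) (\<lambda>_. fn_diff) k \<in> hom (cocycles4 k) (H_FN 4 k)"
proof -
  interpret comm_group "cocycles4 k" by (rule comm_group_cocycles4)
  interpret normal "coboundaries4 k" "cocycles4 k"
    using subgroup_coboundaries4 by (simp add: normal_iff_subgroup)
  show ?thesis using r_coset_hom_Mod unfolding H_FN_def cohom_def cohom_class_def[abs_def] .
qed

text \<open>Two elements lie in the same coset when their difference is a coboundary, and here the
  difference is the sum.\<close>

lemma cohom_class_eq_iff:
  assumes "c \<in> carrier (cocycles4 k)" "c' \<in> carrier (cocycles4 k)"
  shows "cohom_class (FN_deg 4) (\<lambda>_. fn_diff) k c = cohom_class (FN_deg 4) (\<lambda>_. fn_diff) k c' \<longleftrightarrow>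
    c + c' \<in> coboundaries4 k"
proof -
  interpret comm_group "cocycles4 k" by (rule comm_group_cocycles4)
  have "c \<in> coboundaries4 k #>\<^bsub>cocycles4 k\<^esub> c' \<longleftrightarrow> c + c' \<in> coboundaries4 k"
  proof
    assume "c \<in> coboundaries4 k #>\<^bsub>cocycles4 k\<^esub> c'"
    then obtain n where "n \<in> coboundaries4 k" "c = n + c'"
      by (auto simp: r_coset_def cocycle_group_def)
    then show "c + c' \<in> coboundaries4 k" by (simp add: add.assoc add_self_F2)
  next
    assume "c + c' \<in> coboundaries4 k"
    moreover have "c = (c + c') + c'" by (simp add: add.assoc add_self_F2)
    ultimately have "\<exists>n \<in> coboundaries4 k. c = n + c'" by blast
    then show "c \<in> coboundaries4 k #>\<^bsub>cocycles4 k\<^esub> c'"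
      by (simp add: r_coset_def cocycle_group_def)
  qed
  then show ?thesis
    using repr_independence[OF _ assms(2) subgroup_coboundaries4, of c]
      rcos_self[OF assms(1) subgroup_coboundaries4] unfolding cohom_class_def by metis
qed

text \<open>Cocycles of mixed degree are allowed, since the matching argument does not separate
  degrees.\<close>

definition total_cocycles4 :: "fn_cochain set" where
  "total_cocycles4 = {c \<in> FN 4. fn_diff c = 0}"

lemma fn_part_cocycle: "c \<in> total_cocycles4 \<Longrightarrow> fn_part k c \<in> carrier (cocycles4 k)"
  using fn_part_in_FN_deg[of c k] fn_part_fn_diff(1)[of c k] by (simp add: total_cocycles4_def cocycle_group_def)

text \<open>Equality in the direct sum is tested degree by degree. Only finitely many degrees occur,
  so the primitives of the homogeneous parts add up to a single primitive; conversely a primitive is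
  split into its parts.\<close>

lemma fn_class_eq_iff:
  assumes "c \<in> total_cocycles4" "c' \<in> total_cocycles4"
  shows "fn_class 4 c = fn_class 4 c' \<longleftrightarrow> (\<exists>u \<in> FN 4. c + c' = fn_diff u)"
proof -
  have FN: "c + c' \<in> FN 4" using assms by (auto simp: total_cocycles4_def FN_add)
  have "fn_class 4 c = fn_class 4 c' \<longleftrightarrow> (\<forall>k. fn_part k (c + c') \<in> coboundaries4 k)"
    using cohom_class_eq_iff[OF fn_part_cocycle[OF assms(1)] fn_part_cocycle[OF assms(2)]]
    by (simp add: fn_class_def fun_eq_iff fn_part_add)
  also have "\<dots> \<longleftrightarrow> (\<exists>u \<in> FN 4. c + c' = fn_diff u)"
  proof
    assume *: "\<forall>k. fn_part k (c + c') \<in> coboundaries4 k"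
    have "\<exists>u \<in> FN 4. fn_part k (c + c') = fn_diff u" for k
    proof (cases k)
      case 0
      then show ?thesis using *[rule_format, of k] by (intro bexI[of _ 0]) (simp_all add: coboundaries_def FN_4)
    next
      case (Suc j)
      then show ?thesis using *[rule_format, of k] by (auto simp: coboundaries_def FN_deg_4)
    qed
    then obtain u where u: "\<And>k. u k \<in> FN 4" "\<And>k. fn_part k (c + c') = fn_diff (u k)" by metis
    let ?K = "sum_list ` Poly_Mapping.keys (c + c')"
    have "c + c' = (\<Sum>k \<in> ?K. fn_diff (u k))"
      using sum_fn_part[of ?K "c + c'"] u(2) by simp
    then have "c + c' = fn_diff (sum u ?K)" unfolding fn_diff_eq_lin F2_lin_sum .
    then show "\<exists>u \<in> FN 4. c + c' = fn_diff u" using FN_sum[of ?K u] u(1) by blast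
  next
    assume "\<exists>u \<in> FN 4. c + c' = fn_diff u"
    then obtain u where u: "u \<in> FN 4" "c + c' = fn_diff u" by blast
    show "\<forall>k. fn_part k (c + c') \<in> coboundaries4 k"
    proof
      fix k
      show "fn_part k (c + c') \<in> coboundaries4 k"
        using fn_part_fn_diff[OF u(1)] fn_part_in_FN_deg[OF u(1)] unfolding u(2)
        by (cases k) (auto simp: coboundaries_def)
    qed
  qed
  finally show ?thesis .
qed

lemma group_H_FN_4: "group (H_FN 4 k)"
  using comm_group_H_FN_4 by (rule comm_group.axioms)

lemma cohom_class_0: "cohom_class (FN_deg 4) (\<lambda>_. fn_diff) k 0 = \<one>\<^bsub>H_FN 4 k\<^esub>"
  using hom_one[OF cohom_class_hom comm_group.axioms(2)[OF comm_group_cocycles4] group_H_FN_4]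
  by (simp add: cocycle_group_def)

lemma fn_class_in_carrier:
  assumes "c \<in> total_cocycles4"
  shows "fn_class 4 c \<in> carrier (sum_group UNIV (H_FN 4))"
proof -
  have "fn_class 4 c k = \<one>\<^bsub>H_FN 4 k\<^esub>" if "k \<notin> sum_list ` Poly_Mapping.keys c" for k
  proof -
    have "fn_part k c = 0" by (rule F2_eqI) (use that in auto)
    then show ?thesis by (simp add: fn_class_def cohom_class_0)
  qed
  then have "{k. fn_class 4 c k \<noteq> \<one>\<^bsub>H_FN 4 k\<^esub>} \<subseteq> sum_list ` Poly_Mapping.keys c" by blast
  then have "finite {k. fn_class 4 c k \<noteq> \<one>\<^bsub>H_FN 4 k\<^esub>}" by (rule finite_subset) simp
  then show ?thesis
    using hom_in_carrier[OF cohom_class_hom fn_part_cocycle[OF assms]]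
    by (auto simp: carrier_sum_group_UNIV group_H_FN_4 fn_class_def)
qed

lemma fn_class_0: "fn_class 4 0 = \<one>\<^bsub>sum_group UNIV (H_FN 4)\<^esub>"
  by (simp add: fn_class_def cohom_class_0 fun_eq_iff)

lemma fn_class_add:
  assumes "c \<in> total_cocycles4" "c' \<in> total_cocycles4"
  shows "fn_class 4 (c + c') = fn_class 4 c \<otimes>\<^bsub>sum_group UNIV (H_FN 4)\<^esub> fn_class 4 c'"
  using hom_mult[OF cohom_class_hom fn_part_cocycle[OF assms(1)] fn_part_cocycle[OF assms(2)]]
  by (simp add: fn_class_def fun_eq_iff fn_part_add) (simp add: cocycle_group_def)

text \<open>Representatives of the finitely many nontrivial components are added up to one
  inhomogeneous cocycle.\<close>

lemma fn_class_surj: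
  assumes "x \<in> carrier (sum_group UNIV (H_FN 4))"
  obtains c where "c \<in> total_cocycles4" "x = fn_class 4 c"
proof -
  have x: "x k \<in> carrier (H_FN 4 k)" and fin: "finite {k. x k \<noteq> \<one>\<^bsub>H_FN 4 k\<^esub>}" for k
    using assms by (auto simp: carrier_sum_group_UNIV group_H_FN_4)
  have "\<exists>c \<in> carrier (cocycles4 k). x k = cohom_class (FN_deg 4) (\<lambda>_. fn_diff) k c" for k
    using x[of k] by (auto simp: H_FN_def cohom_def FactGroup_def RCOSETS_def cohom_class_def)
  then obtain c where c: "\<And>k. c k \<in> carrier (cocycles4 k)"
    "\<And>k. x k = cohom_class (FN_deg 4) (\<lambda>_. fn_diff) k (c k)" by metis
  let ?K = "{k. x k \<noteq> \<one>\<^bsub>H_FN 4 k\<^esub>}"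
  have deg: "c k \<in> FN_deg 4 k" "fn_diff (c k) = 0" for k
    using c(1)[of k] by (auto simp: cocycle_group_def)
  have part: "fn_part l (c k) = (if l = k then c k else 0)" for k l
    using deg(1)[of k] by (intro F2_eqI) (auto simp: FN_deg_4)
  have part_sum: "fn_part l (sum c I) = (\<Sum>k \<in> I. fn_part l (c k))" for l and I :: "nat set"
    by (induction I rule: infinite_finite_induct) (simp_all add: fn_part_add)
  show thesis
  proof
    have "fn_diff (sum c ?K) = 0"
      using deg(2) by (simp add: fn_diff_eq_lin F2_lin_sum)
    then show "sum c ?K \<in> total_cocycles4"
      using deg(1) by (auto simp: total_cocycles4_def FN_deg_4 intro!: FN_sum)
    show "x = fn_class 4 (sum c ?K)"
    proof
      fix l
      \<comment> \<open>Outside \<open>?K\<close> the part is 0, whose class is the neutral element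
        and hence equals \<open>x l\<close>.\<close>
      have "fn_part l (sum c ?K) = (if l \<in> ?K then c l else 0)"
        unfolding part_sum part using fin by simp
      then show "x l = fn_class 4 (sum c ?K) l"
        using c(2)[of l] by (auto simp: fn_class_def cohom_class_0)
    qed
  qed
qed

lemma crit_cocycle_total: "a \<in> crit3 \<Longrightarrow> crit_cocycle a \<in> total_cocycles4"
  using keys_crit_cocycle fn_D_crit_cocycle by (simp add: total_cocycles4_def FN_4 fn_diff_eq_lin)

text \<open>Existence of an expansion is the decomposition of cocycles given by the matching;
  uniqueness holds because a combination of the given cocycles that is a coboundary is
  trivial.\<close>

lemma F2_basis_H_FN_4: "F2_basis (sum_group UNIV (H_FN 4)) (crit_cocycle ` crit3) (fn_class 4)"
  unfolding F2_basis_def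
proof (intro conjI ballI)
  let ?G = "sum_group UNIV (H_FN 4)" and ?B = "crit_cocycle ` crit3"
  interpret comm_group ?G using comm_group_H_FN_4 by (rule comm_group_sum_group)
  have B: "?B \<subseteq> total_cocycles4" using crit_cocycle_total by blast
  then show "fn_class 4 ` ?B \<subseteq> carrier ?G" using fn_class_in_carrier by blast
  have prod: "finprod ?G (fn_class 4) J = fn_class 4 (\<Sum>J) \<and> \<Sum>J \<in> total_cocycles4"
    if "finite J" "J \<subseteq> ?B" for J
  proof (rule finprod_additive)
    show "0 \<in> total_cocycles4" by (simp add: total_cocycles4_def FN_4)
    show "x + y \<in> total_cocycles4" if "x \<in> total_cocycles4" "y \<in> total_cocycles4" for x y
      using that by (simp add: total_cocycles4_def FN_add fn_diff_add)
  qed (use that B fn_class_in_carrier fn_class_0 fn_class_add in auto)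
  \<comment> \<open>Sets of given cocycles correspond to formal combinations of critical sequences;
    injectivity ensures that distinct sequences contribute distinct cocycles.\<close>
  have J: "\<exists>e. Poly_Mapping.keys e \<subseteq> crit3 \<and> F2_lin crit_cocycle e = \<Sum>J \<and> J = crit_cocycle ` Poly_Mapping.keys e"
    if fin: "finite J" and J: "J \<subseteq> ?B" for J
  proof -
    obtain I where I: "I \<subseteq> crit3" "finite I" "J = crit_cocycle ` I"
      using finite_subset_image[OF fin J] by blast
    have "inj_on crit_cocycle I" using crit_cocycle_inj I(1) by (rule inj_on_subset)
    then have "F2_lin crit_cocycle (F2_ind I) = \<Sum>J"
      using I(2) by (simp add: F2_lin_ind I(3) sum.reindex)
    then show ?thesis using I by (intro exI[of _ "F2_ind I"]) simp
  qed
  fix x assume "x \<in> carrier ?G"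
  then obtain c where c: "c \<in> total_cocycles4" "x = fn_class 4 c" by (rule fn_class_surj)
  show "\<exists>!J. finite J \<and> J \<subseteq> ?B \<and> x = finprod ?G (fn_class 4) J"
  proof (rule ex_ex1I)
    obtain e u where e: "Poly_Mapping.keys e \<subseteq> crit3" and u: "Poly_Mapping.keys u \<subseteq> src3"
      and eq: "c = F2_lin crit_cocycle e + F2_lin fn_D u"
      using FN4.cocycle_decomposition[of c] c(1)
      by (auto simp: total_cocycles4_def FN_4 src3_tgt3_crit3 fn_diff_eq_lin)
    let ?J = "crit_cocycle ` Poly_Mapping.keys e"
    have J': "finite ?J" "?J \<subseteq> ?B" using e by auto
    have "inj_on crit_cocycle (Poly_Mapping.keys e)" using crit_cocycle_inj e by (rule inj_on_subset)
    then have sum: "F2_lin crit_cocycle e = \<Sum>?J"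
      by (simp add: F2_lin_def sum.reindex)
    have "c + \<Sum>?J = fn_diff u" unfolding eq sum fn_diff_eq_lin
      by (simp add: add_ac add_self_F2 add_left_self_F2)
    moreover have "u \<in> FN 4" using u src3_tgt3_crit3 by (auto simp: FN_4)
    ultimately have "x = finprod ?G (fn_class 4) ?J"
      unfolding c(2) using prod[OF J'] fn_class_eq_iff[OF c(1)] by auto
    then show "\<exists>J. finite J \<and> J \<subseteq> ?B \<and> x = finprod ?G (fn_class 4) J"
      using J' by blast
  next
    fix J J' assume J1: "finite J \<and> J \<subseteq> ?B \<and> x = finprod ?G (fn_class 4) J"
      and J2: "finite J' \<and> J' \<subseteq> ?B \<and> x = finprod ?G (fn_class 4) J'"
    obtain e where e: "Poly_Mapping.keys e \<subseteq> crit3" "F2_lin crit_cocycle e = \<Sum>J"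
      "J = crit_cocycle ` Poly_Mapping.keys e" using J J1 by blast
    obtain e' where e': "Poly_Mapping.keys e' \<subseteq> crit3" "F2_lin crit_cocycle e' = \<Sum>J'"
      "J' = crit_cocycle ` Poly_Mapping.keys e'" using J J2 by blast
    have "fn_class 4 (\<Sum>J) = fn_class 4 (\<Sum>J')" using prod J1 J2 by metis
    then obtain u where u: "u \<in> FN 4" "\<Sum>J + \<Sum>J' = fn_diff u"
      using fn_class_eq_iff[of "\<Sum>J" "\<Sum>J'"] prod J1 J2 by blast
    \<comment> \<open>The sum of the two combinations is their difference, and it is a
      coboundary.\<close>
    have "F2_lin crit_cocycle (e + e') = F2_lin fn_D u"
      using u(2) e(2) e'(2) by (simp add: fn_diff_eq_lin)
    moreover have "Poly_Mapping.keys (e + e') \<subseteq> crit3" using e(1) e'(1) by (auto simp: keys_add_F2)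
    moreover have "Poly_Mapping.keys u \<subseteq> src3 \<union> tgt3 \<union> crit3" using u(1) by (simp add: src3_tgt3_crit3 FN_4)
    ultimately have "e + e' = 0" by (intro FN4.coboundary_imp_0)
    then show "J = J'" using e(3) e'(3) by (simp add: F2_add_eq_0_iff)
  qed
qed

section \<open>The basis and its transport to the classifying space\<close>

theorem theorem3p1:
  shows
    "let B = {fn [a,0,0] + fn [0,a,0] + fn [0,0,a] | a. 0 < a}
           \<union> {fn [a,0,b] + fn [b,0,a] | a b. 0 < a \<and> a < b}
           \<union> {fn [b,a,b] | a b. a \<le> b}
     in (\<forall>c \<in> B. c \<in> FN 4 \<and> fn_diff c = 0) \<and>
        F2_basis (sum_group UNIV (H_FN 4)) B (fn_class 4) \<and>
        (\<forall>\<Phi>. FN_identification 4 \<Phi> \<longrightarrow>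
           F2_basis (sum_group UNIV (H_sing (BS 4))) B (\<lambda>c k. \<Phi> k (fn_class 4 c k)))"
  unfolding Let_def crit_cocycle_image[symmetric]
proof (intro conjI allI impI)
  show "\<forall>c \<in> crit_cocycle ` crit3. c \<in> FN 4 \<and> fn_diff c = 0"
    using crit_cocycle_total by (auto simp: total_cocycles4_def)
  show basis: "F2_basis (sum_group UNIV (H_FN 4)) (crit_cocycle ` crit3) (fn_class 4)"
    by (rule F2_basis_H_FN_4)
  fix \<Phi> assume "FN_identification 4 \<Phi>"
  then have iso: "\<Phi> k \<in> iso (H_FN 4 k) (H_sing (BS 4) k)" for k
    by (simp add: FN_identification_def)
  \<comment> \<open>The group laws are carried over from the Fox-Neuwirth side in each
    degree.\<close>
  have H: "comm_group (H_sing (BS 4) k)" for k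
    using comm_group_H_FN_4 iso H_sing_one by (rule comm_group_iso_idempotent)
  show "F2_basis (sum_group UNIV (H_sing (BS 4))) (crit_cocycle ` crit3) (\<lambda>c k. \<Phi> k (fn_class 4 c k))"
  proof (rule F2_basis_iso[OF _ _ _ basis])
    \<comment> \<open>The degreewise isomorphisms assemble to one of direct sums, which sends
      \<open>fn_class 4 c\<close> to the stated family.\<close>
    show "(\<lambda>x k. \<Phi> k (x k)) \<in> iso (sum_group UNIV (H_FN 4)) (sum_group UNIV (H_sing (BS 4)))"
      using group_H_FN_4 comm_group.axioms(2)[OF H] iso by (rule iso_sum_group)
  qed (use comm_group_H_FN_4 H in \<open>auto intro: comm_group_sum_group\<close>)
qed

end
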